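(* Let $(X,d,\mu)$ be a quasi-metric-measure space. If $\mu(X)<\infty$, then for any $\alpha,p\in(0,\infty)$, $q\in(0,\infty]$, and $\tilde p\in(0,p)$, the embeddings $$M^\alpha_{p,q}(X,d,\mu)\hookrightarrow L^{\tilde p}(X,\mu)\quad\text{and}\quad N^\alpha_{p,q}(X,d,\mu)\hookrightarrow L^{\tilde p}(X,\mu)$$ are compact. On the other hand, if either one of these two embeddings is continuous for some $p\in(0,\infty)$, $\tilde p\in(0,p)$, $q\in(0,\infty]$, and $\alpha\in(0,\infty)$ with $\alpha\preceq_q\mathrm{ind}(X,d)$, then $\mu(X)<\infty$.
   Context: A quasi-metric space $(X,d)$ is a set $X$ with at least two elements and a function $d:X\times X\to[0,\infty)$ for which there are constants $C_0,C_1\in(0,\infty)$ such that for all $x,y,z\in X$: $d(x,y)=0$ iff $x=y$; $d(y,x)\le C_0 d(x,y)$; $d(x,y)\le C_1\max\{d(x,z),d(z,y)\}$ (symmetry is not required). For a quasi-metric $\rho$, $C_\rho:=\sup\frac{\rho(x,y)}{\max\{\rho(x,z),\rho(z,y)\}}\in[1,\infty)$, the supremum over all $x,y,z\in X$ not all equal. Balls are $B_d(x,r):=\{y\in X:d(x,y)<r\}$. The topology $\tau_d$ consists of all $\mathcal O\subseteq X$ such that for each $x\in\mathcal O$ there is $r>0$ with $B_d(x,r)\subseteq\mathcal O$. A quasi-metric-measure space $(X,d,\mu)$ is a quasi-metric space with a nonnegative measure $\mu$ on a $\sigma$-algebra containing the Borel sets of $\tau_d$, such that all $d$-balls are measurable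 and $\mu(B_d(x,r))\in(0,\infty)$ for all $x\in X$, $r\in(0,\infty)$. Quasi-metrics $d,\rho$ are equivalent ($\rho\approx d$) if $\kappa^{-1}\rho\le d\le\kappa\rho$ on $X\times X$ for some constant $\kappa>0$. $\mathrm{ind}(X,d):=\sup_{\rho\approx d}(\log_2C_\rho)^{-1}\in(0,\infty]$ (with $1/0:=\infty$). The notation $\alpha\preceq_q\mathrm{ind}(X,d)$ means $\alpha\le\mathrm{ind}(X,d)$, where $\alpha=\mathrm{ind}(X,d)$ is permitted only when $q=\infty$ and the supremum defining $\mathrm{ind}(X,d)$ is attained. Fractional gradients: for $\alpha\in(0,\infty)$ and measurable $u:X\to\mathbb R$, $\mathbb D^\alpha_d(u)$ is the set of sequences $\vec g=\{g_k\}_{k\in\mathbb Z}$ of nonnegative measurable functions on $X$ for which there is a measurable $E$ with $\mu(E)=0$ and $|u(x)-u(y)|\le[d(x,y)]^\alpha(g_k(x)+g_k(y))$ for all $k\in\mathbb Z$ and $x,y\in X\setminus E$ with $2^{-k-1}\le d(x,y)<2^{-k}$. The Hajłasz–Triebel–Lizorkin space $M^\alpha_{p,q}(X,d,\mu)$ is the set of $u\in L^p(X,\mu)$ with finite (quasi-)norm $\|u\|_{L^p(X,\mu)}+\inf_{\vec g\in\mathbb D^\alpha_d(u)}\big\|\,\|\{g_k\}_k\|_{\ell^q(\mathbb Z)}\big\|_{L^p(X,\mu)}$; the Hajłasz–Besov space $N^\alpha_{p,q}(X,d,\mu)$ is the set of $u\in L^p(X,\mu)$ with finite (quasi-)norm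 $\|u\|_{L^p(X,\mu)}+\inf_{\vec g\in\mathbb D^\alpha_d(u)}\big\|\{\|g_k\|_{L^p(X,\mu)}\}_k\big\|_{\ell^q(\mathbb Z)}$. An embedding is continuous if the inclusion is well defined and bounded for the (quasi-)norms; it is compact if it moreover maps bounded sets to totally bounded sets. *)

theory Defs
  imports "HOL-Analysis.Analysis"
begin

section \<open>Quasi-metric spaces\<close>

text \<open>A quasi-metric on a carrier \<open>X\<close> is a function on the whole type of which only the values
  on \<open>X \<times> X\<close> matter.\<close>

definition quasi_metric_on :: "'a set \<Rightarrow> ('a \<Rightarrow> 'a \<Rightarrow> real) \<Rightarrow> bool" where
  "quasi_metric_on X d \<longleftrightarrow>
     (\<exists>x\<in>X. \<exists>y\<in>X. x \<noteq> y) \<and>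
     (\<forall>x\<in>X. \<forall>y\<in>X. 0 \<le> d x y \<and> (d x y = 0 \<longleftrightarrow> x = y)) \<and>
     (\<exists>C0>0. \<forall>x\<in>X. \<forall>y\<in>X. d y x \<le> C0 * d x y) \<and>
     (\<exists>C1>0. \<forall>x\<in>X. \<forall>y\<in>X. \<forall>z\<in>X. d x y \<le> C1 * max (d x z) (d z y))"

definition qm_const :: "'a set \<Rightarrow> ('a \<Rightarrow> 'a \<Rightarrow> real) \<Rightarrow> real" where
  "qm_const X \<rho> = Sup {\<rho> x y / max (\<rho> x z) (\<rho> z y) | x y z.
     x \<in> X \<and> y \<in> X \<and> z \<in> X \<and> \<not> (x = y \<and> y = z)}"

definition qball :: "'a set \<Rightarrow> ('a \<Rightarrow> 'a \<Rightarrow> real) \<Rightarrow> 'a \<Rightarrow> real \<Rightarrow> 'a set" where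
  "qball X d x r = {y \<in> X. d x y < r}"

definition qtopology :: "'a set \<Rightarrow> ('a \<Rightarrow> 'a \<Rightarrow> real) \<Rightarrow> 'a set set" where
  "qtopology X d = {U. U \<subseteq> X \<and> (\<forall>x\<in>U. \<exists>r>0. qball X d x r \<subseteq> U)}"

definition equivalent_qm ::
  "'a set \<Rightarrow> ('a \<Rightarrow> 'a \<Rightarrow> real) \<Rightarrow> ('a \<Rightarrow> 'a \<Rightarrow> real) \<Rightarrow> bool" where
  "equivalent_qm X \<rho> d \<longleftrightarrow>
     (\<exists>\<kappa>>0. \<forall>x\<in>X. \<forall>y\<in>X. inverse \<kappa> * \<rho> x y \<le> d x y \<and> d x y \<le> \<kappa> * \<rho> x y)"

definition equivalent_qms :: "'a set \<Rightarrow> ('a \<Rightarrow> 'a \<Rightarrow> real) \<Rightarrow> ('a \<Rightarrow> 'a \<Rightarrow> real) set" where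
  "equivalent_qms X d = {\<rho>. quasi_metric_on X \<rho> \<and> equivalent_qm X \<rho> d}"

text \<open>Since \<open>qm_const X \<rho> \<ge> 1\<close>, the logarithm is nonnegative and \<open>ennreal\<close> truncates nothing;
  the inverse on \<open>ennreal\<close> satisfies \<open>inverse 0 = \<infinity>\<close>.\<close>

definition qm_exponent :: "'a set \<Rightarrow> ('a \<Rightarrow> 'a \<Rightarrow> real) \<Rightarrow> ennreal" where
  "qm_exponent X \<rho> = inverse (ennreal (log 2 (qm_const X \<rho>)))"

definition qm_index :: "'a set \<Rightarrow> ('a \<Rightarrow> 'a \<Rightarrow> real) \<Rightarrow> ennreal" where
  "qm_index X d = (SUP \<rho>\<in>equivalent_qms X d. qm_exponent X \<rho>)"

definition preceq_index :: "real \<Rightarrow> ennreal \<Rightarrow> 'a set \<Rightarrow> ('a \<Rightarrow> 'a \<Rightarrow> real) \<Rightarrow> bool" where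
  "preceq_index \<alpha> q X d \<longleftrightarrow>
     ennreal \<alpha> \<le> qm_index X d \<and>
     (ennreal \<alpha> = qm_index X d \<longrightarrow>
        q = \<infinity> \<and> (\<exists>\<rho>\<in>equivalent_qms X d. qm_exponent X \<rho> = qm_index X d))"

definition quasi_metric_measure_space :: "'a measure \<Rightarrow> ('a \<Rightarrow> 'a \<Rightarrow> real) \<Rightarrow> bool" where
  "quasi_metric_measure_space M d \<longleftrightarrow>
     quasi_metric_on (space M) d \<and>
     sigma_sets (space M) (qtopology (space M) d) \<subseteq> sets M \<and>
     (\<forall>x\<in>space M. \<forall>r>0. qball (space M) d x r \<in> sets M \<and>
        0 < emeasure M (qball (space M) d x r) \<and> emeasure M (qball (space M) d x r) < \<infinity>)"


section \<open>Lebesgue and sequence (quasi-)norms\<close>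

text \<open>Functions are not identified almost everywhere: the spaces below are sets of functions, and
  the (quasi-)norms are \<open>ennreal\<close>-valued functionals that depend only on the almost-everywhere
  class of their argument.\<close>

definition ennpowr :: "ennreal \<Rightarrow> real \<Rightarrow> ennreal" where
  \<comment> \<open>used for exponents \<open>s > 0\<close> only\<close>
  "ennpowr x s = (if x = \<infinity> then \<infinity> else ennreal (enn2real x powr s))"

definition enn_Lp_norm :: "'b measure \<Rightarrow> real \<Rightarrow> ('b \<Rightarrow> ennreal) \<Rightarrow> ennreal" where
  "enn_Lp_norm M p f = ennpowr (\<integral>\<^sup>+ x. ennpowr (f x) p \<partial>M) (1 / p)"

definition Lp_norm :: "'a measure \<Rightarrow> real \<Rightarrow> ('a \<Rightarrow> real) \<Rightarrow> ennreal" where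
  "Lp_norm M p u = enn_Lp_norm M p (\<lambda>x. ennreal \<bar>u x\<bar>)"

definition Lp_space :: "'a measure \<Rightarrow> real \<Rightarrow> ('a \<Rightarrow> real) set" where
  "Lp_space M p = {u \<in> borel_measurable M. Lp_norm M p u < \<infinity>}"

definition lq_norm :: "ennreal \<Rightarrow> (int \<Rightarrow> ennreal) \<Rightarrow> ennreal" where
  "lq_norm q a =
     (if q = \<infinity> then (SUP k. a k) else enn_Lp_norm (count_space UNIV) (enn2real q) a)"


section \<open>Haj\l{}asz--Triebel--Lizorkin and Haj\l{}asz--Besov spaces\<close>

definition fractional_gradients ::
  "'a measure \<Rightarrow> ('a \<Rightarrow> 'a \<Rightarrow> real) \<Rightarrow> real \<Rightarrow> ('a \<Rightarrow> real) \<Rightarrow> (int \<Rightarrow> 'a \<Rightarrow> real) set" where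
  "fractional_gradients M d \<alpha> u =
     {g. (\<forall>k. g k \<in> borel_measurable M \<and> (\<forall>x\<in>space M. 0 \<le> g k x)) \<and>
         (\<exists>E\<in>null_sets M. \<forall>k. \<forall>x\<in>space M - E. \<forall>y\<in>space M - E.
            2 powi (- k - 1) \<le> d x y \<and> d x y < 2 powi (- k) \<longrightarrow>
            \<bar>u x - u y\<bar> \<le> d x y powr \<alpha> * (g k x + g k y))}"

definition TL_norm ::
  "'a measure \<Rightarrow> ('a \<Rightarrow> 'a \<Rightarrow> real) \<Rightarrow> real \<Rightarrow> real \<Rightarrow> ennreal \<Rightarrow> ('a \<Rightarrow> real) \<Rightarrow> ennreal" where
  "TL_norm M d \<alpha> p q u = Lp_norm M p u +
     (INF g\<in>fractional_gradients M d \<alpha> u.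
        enn_Lp_norm M p (\<lambda>x. lq_norm q (\<lambda>k. ennreal (g k x))))"

definition Besov_norm ::
  "'a measure \<Rightarrow> ('a \<Rightarrow> 'a \<Rightarrow> real) \<Rightarrow> real \<Rightarrow> real \<Rightarrow> ennreal \<Rightarrow> ('a \<Rightarrow> real) \<Rightarrow> ennreal" where
  "Besov_norm M d \<alpha> p q u = Lp_norm M p u +
     (INF g\<in>fractional_gradients M d \<alpha> u. lq_norm q (\<lambda>k. Lp_norm M p (g k)))"

definition TL_space ::
  "'a measure \<Rightarrow> ('a \<Rightarrow> 'a \<Rightarrow> real) \<Rightarrow> real \<Rightarrow> real \<Rightarrow> ennreal \<Rightarrow> ('a \<Rightarrow> real) set" where
  "TL_space M d \<alpha> p q = {u \<in> Lp_space M p. TL_norm M d \<alpha> p q u < \<infinity>}"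

definition Besov_space ::
  "'a measure \<Rightarrow> ('a \<Rightarrow> 'a \<Rightarrow> real) \<Rightarrow> real \<Rightarrow> real \<Rightarrow> ennreal \<Rightarrow> ('a \<Rightarrow> real) set" where
  "Besov_space M d \<alpha> p q = {u \<in> Lp_space M p. Besov_norm M d \<alpha> p q u < \<infinity>}"


section \<open>Embeddings of quasi-normed function spaces\<close>

definition continuous_embedding ::
  "('a \<Rightarrow> real) set \<Rightarrow> (('a \<Rightarrow> real) \<Rightarrow> ennreal) \<Rightarrow>
   ('a \<Rightarrow> real) set \<Rightarrow> (('a \<Rightarrow> real) \<Rightarrow> ennreal) \<Rightarrow> bool" where
  "continuous_embedding A nA B nB \<longleftrightarrow>
     A \<subseteq> B \<and> (\<exists>C::real. 0 \<le> C \<and> (\<forall>u\<in>A. nB u \<le> ennreal C * nA u))"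

definition norm_totally_bounded :: "(('a \<Rightarrow> real) \<Rightarrow> ennreal) \<Rightarrow> ('a \<Rightarrow> real) set \<Rightarrow> bool" where
  "norm_totally_bounded nB S \<longleftrightarrow>
     (\<forall>\<epsilon>::real. 0 < \<epsilon> \<longrightarrow>
        (\<exists>F. finite F \<and> F \<subseteq> S \<and> (\<forall>u\<in>S. \<exists>v\<in>F. nB (\<lambda>x. u x - v x) < ennreal \<epsilon>)))"

definition compact_embedding ::
  "('a \<Rightarrow> real) set \<Rightarrow> (('a \<Rightarrow> real) \<Rightarrow> ennreal) \<Rightarrow>
   ('a \<Rightarrow> real) set \<Rightarrow> (('a \<Rightarrow> real) \<Rightarrow> ennreal) \<Rightarrow> bool" where
  "compact_embedding A nA B nB \<longleftrightarrow>
     continuous_embedding A nA B nB \<and>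
     (\<forall>S\<subseteq>A. (\<exists>R::real. \<forall>u\<in>S. nA u \<le> ennreal R) \<longrightarrow> norm_totally_bounded nB S)"

end

theory Submission
  imports Defs
begin

text \<open>
  \<^bold>\<open>Finite measure implies compactness.\<close> For every \<open>q\<close>, a bound on either norm gives a bound on
  \<open>\<parallel>u\<parallel>\<^sub>p\<close> and a fractional gradient with \<open>sup\<^sub>k \<parallel>g\<^sub>k\<parallel>\<^sub>p\<close> bounded
  (\<open>gradient_of_finite_norm\<close>), so both spaces are treated at once. By Chebyshev's inequality the
  set where \<open>g\<^sub>k > \<eta> 2\<^bsup>k\<alpha>\<^esup>\<close> for some \<open>k \<ge> m\<close> has measure at most a
  geometric tail, uniformly over the family; off this set \<open>u\<close> oscillates by at most \<open>2\<eta>\<close> at scale \<open>2\<^bsup>-m\<^esup>\<close> (\<open>uniform_oscillation_bound\<close>).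
  Since balls have positive measure and the total mass is finite, finitely many small balls cover the
  space up to a set of small measure (\<open>finitely_many_balls_cover\<close>). A function of the family is
  therefore determined, up to a small error off a small set, by one rounded value on each of finitely
  many balls, and these data take finitely many values: the family is totally bounded in measure
  (\<open>finite_net_in_measure\<close>). A bound in \<open>L\<^sup>p\<close> upgrades closeness in measure to closeness in
  \<open>L\<^bsup>p'\<^esup>\<close> for \<open>p' < p\<close> (\<open>Lp_norm_le_of_small_in_measure\<close>).

  \<^bold>\<open>Continuity implies finite measure.\<close> The hypothesis on the index provides an equivalent quasi-metric
  \<open>\<rho>\<close> with \<open>C\<^sub>\<rho> \<le> 2\<^bsup>1/\<beta>\<^esup>\<close>, where \<open>\<beta> \<ge> \<alpha>\<close>, strictly unless \<open>q = \<infinity>\<close>. Then \<open>\<delta> = \<rho>\<^sup>\<beta>\<close> satisfies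
  \<open>\<delta>(x,y) \<le> 2 max(\<delta>(x,z), \<delta>(z,y))\<close>, and Frink's chain construction gives a function \<open>f \<ge> \<delta>(w,\<cdot>)/4\<close>
  that is Hoelder continuous of exponent \<open>\<beta>\<close>; its sublevel sets lie in balls about the base
  point \<open>w\<close> and have finite measure (\<open>exists_Holder_gauge\<close>). Testing the embedding on the functions that
  are \<open>1\<close> on \<open>{f < r}\<close>,
  \<open>0\<close> off \<open>{f < r + h}\<close> and affine in \<open>f\<close> in between, with \<open>h \<le> 1\<close>, shows for \<open>m(r) = \<mu>{f < r}\<close> that
  \<open>m(r)\<^bsup>1/p'\<^esup> \<le> (K/h) m(r+h)\<^bsup>1/p\<^esup>\<close>. The exponent on the left is the larger one, so if \<open>m(r)\<close> exceeds a
  threshold independent of \<open>r\<close>, iteration with \<open>h = 1/2, 1/4, \<dots>\<close> forces the increasing function \<open>m\<close> to be unbounded on the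
  interval \<open>[r, r+1]\<close>. Hence \<open>m\<close> is bounded (\<open>bounded_of_self_improving_growth\<close>), and its supremum is the total mass.
\<close>

section \<open>Powers and Lebesgue norms of extended nonnegative functions\<close>

lemma ennpowr_ennreal: "0 \<le> a \<Longrightarrow> ennpowr (ennreal a) s = ennreal (a powr s)"
  by (simp add: ennpowr_def)

lemma ennpowr_top [simp]: "ennpowr top s = top"
  by (simp add: ennpowr_def)

lemma ennpowr_zero [simp]: "ennpowr 0 s = 0"
  by (simp add: ennpowr_def)

lemma ennpowr_one [simp]: "ennpowr 1 s = 1"
  by (simp add: ennpowr_def)

lemma ennpowr_mono: "x \<le> y \<Longrightarrow> 0 < s \<Longrightarrow> ennpowr x s \<le> ennpowr y s"
  by (cases x; cases y) (auto simp: ennpowr_ennreal top_unique intro!: ennreal_leI powr_mono2)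

lemma ennpowr_mult: "0 < s \<Longrightarrow> ennpowr (x * y) s = ennpowr x s * ennpowr y s"
  by (cases x; cases y)
    (auto simp: ennpowr_ennreal powr_mult ennreal_mult_top ennreal_top_mult
      simp flip: ennreal_mult)

lemma ennpowr_ennpowr_inverse:
  assumes "0 < s"
  shows "ennpowr (ennpowr x s) (1 / s) = x" "ennpowr (ennpowr x (1 / s)) s = x"
  using assms by (cases x; simp add: ennpowr_ennreal powr_powr)+

lemma borel_measurable_ennpowr [measurable (raw)]:
  assumes [measurable]: "f \<in> borel_measurable M"
  shows "(\<lambda>x. ennpowr (f x) s) \<in> borel_measurable M"
  unfolding ennpowr_def by measurable

lemma enn_Lp_norm_mono:
  assumes "0 < p" "\<And>x. x \<in> space M \<Longrightarrow> f x \<le> g x"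
  shows "enn_Lp_norm M p f \<le> enn_Lp_norm M p g"
  unfolding enn_Lp_norm_def using assms
  by (intro ennpowr_mono nn_integral_mono) auto

lemma enn_Lp_norm_cmult:
  assumes "0 < p" "f \<in> borel_measurable M"
  shows "enn_Lp_norm M p (\<lambda>x. c * f x) = c * enn_Lp_norm M p f"
  unfolding enn_Lp_norm_def using assms
  by (simp add: ennpowr_mult nn_integral_cmult ennpowr_ennpowr_inverse)

lemma enn_Lp_norm_indicator:
  assumes "0 < p" "A \<in> sets M"
  shows "enn_Lp_norm M p (indicator A) = ennpowr (emeasure M A) (1 / p)"
proof -
  have "(\<lambda>x. ennpowr (indicator A x) p) = indicator A"
    by (auto simp: indicator_def)
  then show ?thesis
    using assms by (simp add: enn_Lp_norm_def)
qed

text \<open>Rephrases norm bounds as bounds on integrals, where additivity and monotonicity are available.\<close>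

lemma Lp_norm_le_iff:
  assumes "0 < p" "0 \<le> R"
  shows "Lp_norm M p u \<le> ennreal R
    \<longleftrightarrow> (\<integral>\<^sup>+ x. ennreal (\<bar>u x\<bar> powr p) \<partial>M) \<le> ennreal (R powr p)" (is "_ \<longleftrightarrow> ?I \<le> _")
proof -
  have I: "Lp_norm M p u = ennpowr ?I (1 / p)"
    by (simp add: Lp_norm_def enn_Lp_norm_def ennpowr_ennreal)
  have "?I \<le> ennreal (R powr p)" if "ennpowr ?I (1 / p) \<le> ennreal R"
    using ennpowr_mono[OF that assms(1)] assms
    by (simp add: ennpowr_ennpowr_inverse ennpowr_ennreal)
  moreover have "ennpowr ?I (1 / p) \<le> ennreal R" if "?I \<le> ennreal (R powr p)"
    using ennpowr_mono[OF that, of "1 / p"] assms by (simp add: ennpowr_ennreal powr_powr)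
  ultimately show ?thesis
    unfolding I by blast
qed

lemma le_lq_norm:
  assumes "0 < q"
  shows "a k \<le> lq_norm q a"
proof (cases "q = \<infinity>")
  case True
  then show ?thesis
    by (simp add: lq_norm_def SUP_upper)
next
  case False
  then have q: "0 < enn2real q"
    using assms by (simp add: enn2real_positive_iff less_top)
  have "a k = ennpowr (\<integral>\<^sup>+ j. ennpowr (a j) (enn2real q) * indicator {k} j \<partial>count_space UNIV)
    (1 / enn2real q)"
    using q by (simp add: ennpowr_ennpowr_inverse)
  also have "\<dots> \<le> lq_norm q a"
    using q False unfolding lq_norm_def enn_Lp_norm_def
    by (auto intro!: ennpowr_mono nn_integral_mono simp: indicator_def)
  finally show ?thesis .
qed

lemma lq_norm_cmult:
  assumes "0 < q"
  shows "lq_norm q (\<lambda>k. c * a k) = c * lq_norm q a"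
proof (cases "q = \<infinity>")
  case True
  then show ?thesis
    by (simp add: lq_norm_def SUP_mult_left_ennreal)
next
  case False
  then have q: "0 < enn2real q"
    using assms by (simp add: enn2real_positive_iff less_top)
  then show ?thesis
    using False by (simp add: lq_norm_def enn_Lp_norm_cmult)
qed

text \<open>Each single \<open>g\<^sub>k\<close> is dominated by the \<open>\<ell>\<^sup>q\<close> norm of the sequence, whether that norm is taken inside
  or outside the \<open>L\<^sup>p\<close> norm. The added \<open>1\<close> is there because the infimum over the gradients need not be attained.\<close>

lemma gradient_of_finite_norm:
  assumes "0 < p" "0 < q"
    and "TL_norm M d \<alpha> p q u \<le> ennreal R \<or> Besov_norm M d \<alpha> p q u \<le> ennreal R"
  shows "\<exists>g\<in>fractional_gradients M d \<alpha> u. \<forall>k. Lp_norm M p (g k) \<le> ennreal (max R 0 + 1)"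
proof -
  let ?T = "\<lambda>g. enn_Lp_norm M p (\<lambda>x. lq_norm q (\<lambda>k. ennreal (g k x)))"
  let ?B = "\<lambda>g. lq_norm q (\<lambda>k. Lp_norm M p (g k))"
  have less: "ennreal R < ennreal (max R 0 + 1)"
    by (simp add: ennreal_less_iff ennreal_eq_0_iff max_def)
  have "(INF g\<in>fractional_gradients M d \<alpha> u. ?T g) < ennreal (max R 0 + 1) \<or>
        (INF g\<in>fractional_gradients M d \<alpha> u. ?B g) < ennreal (max R 0 + 1)"
    using assms(3) less unfolding TL_norm_def Besov_norm_def
    by (meson add_increasing le_less_trans order_refl zero_le)
  then obtain g where g: "g \<in> fractional_gradients M d \<alpha> u"
    and le: "?T g \<le> ennreal (max R 0 + 1) \<or> ?B g \<le> ennreal (max R 0 + 1)"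
    by (auto simp: INF_less_iff dest: less_imp_le)
  have "Lp_norm M p (g k) \<le> ?T g" for k
    unfolding Lp_norm_def
  proof (intro enn_Lp_norm_mono assms)
    fix x assume "x \<in> space M"
    then have "\<bar>g k x\<bar> = g k x"
      using g by (simp add: fractional_gradients_def)
    then show "ennreal \<bar>g k x\<bar> \<le> lq_norm q (\<lambda>k. ennreal (g k x))"
      using le_lq_norm[OF assms(2), of "\<lambda>k. ennreal (g k x)"] by simp
  qed
  moreover have "Lp_norm M p (g k) \<le> ?B g" for k
    using le_lq_norm[OF assms(2), of "\<lambda>k. Lp_norm M p (g k)" k] .
  ultimately show ?thesis
    using g le order_trans by blast
qed

section \<open>Convergence in measure and Lebesgue norms of lower exponent\<close>

text \<open>Splitting at height \<open>T\<close>: below \<open>T\<close> the first summand dominates, above \<open>T\<close> the second. Integrated,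
  this replaces Hoelder's inequality: a small set contributes little through the first summand, and a
  large \<open>T\<close> makes the second summand small.\<close>

lemma powr_le_add_powr:
  fixes a T p r :: real
  assumes "0 \<le> a" "0 < T" "0 < r" "r < p"
  shows "a powr r \<le> T powr r + T powr (r - p) * a powr p"
proof (cases "a \<le> T")
  case True
  then have "a powr r \<le> T powr r"
    using assms by (intro powr_mono2) auto
  then show ?thesis
    by (simp add: add_increasing2)
next
  case False
  have "a powr r = a powr (r - p) * a powr p"
    using False assms by (simp flip: powr_add)
  also have "\<dots> \<le> T powr (r - p) * a powr p"
    using False assms by (intro mult_right_mono powr_mono2') auto
  finally show ?thesis
    by (simp add: add_increasing)
qed

text \<open>The splitting inequality with \<open>T = N\<close>, for any \<open>N > 0\<close> with \<open>\<parallel>u\<parallel>\<^sub>p \<le> N\<close>, gives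
  \<open>\<integral> |u|\<^bsup>p'\<^esup> \<le> N\<^bsup>p'\<^esup> (\<mu>(X) + 1)\<close>. Letting \<open>N\<close> decrease to \<open>\<parallel>u\<parallel>\<^sub>p\<close> covers functions of norm zero as well.\<close>

lemma continuous_embedding_Lp:
  fixes M :: "'a measure"
  assumes fin: "emeasure M (space M) < \<infinity>" and p': "0 < p'" "p' < p"
  shows "\<exists>C>0. \<forall>u\<in>borel_measurable M. Lp_norm M p' u \<le> ennreal C * Lp_norm M p u"
proof (intro exI conjI ballI)
  let ?C = "(measure M (space M) + 1) powr (1 / p')"
  have V: "emeasure M (space M) = ennreal (measure M (space M))"
    using fin by (intro emeasure_eq_ennreal_measure) auto
  show C: "0 < ?C"
    by (simp add: add_nonneg_eq_0_iff)
  fix u :: "'a \<Rightarrow> real" assume u [measurable]: "u \<in> borel_measurable M"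
  have bound: "Lp_norm M p' u \<le> ennreal (?C * N)"
    if "0 < N" "Lp_norm M p u \<le> ennreal N" for N
  proof -
    have "(\<integral>\<^sup>+ x. ennreal (\<bar>u x\<bar> powr p') \<partial>M)
      \<le> (\<integral>\<^sup>+ x. ennreal (N powr p') + ennreal (N powr (p' - p)) * ennreal (\<bar>u x\<bar> powr p) \<partial>M)"
      using powr_le_add_powr[OF abs_ge_zero that(1) p']
      by (intro nn_integral_mono) (simp flip: ennreal_mult ennreal_plus)
    also have "\<dots> = ennreal (N powr p') * emeasure M (space M)
        + ennreal (N powr (p' - p)) * (\<integral>\<^sup>+ x. ennreal (\<bar>u x\<bar> powr p) \<partial>M)"
      by (subst nn_integral_add) (auto simp: nn_integral_cmult)
    also have "\<dots> \<le> ennreal (N powr p') * emeasure M (space M)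
        + ennreal (N powr (p' - p)) * ennreal (N powr p)"
      using that p' by (intro add_left_mono mult_left_mono) (simp_all flip: Lp_norm_le_iff)
    also have "\<dots> = ennreal (N powr p' * (measure M (space M) + 1))"
      unfolding V by (simp add: distrib_left flip: ennreal_mult ennreal_plus powr_add)
    also have "\<dots> = ennreal ((?C * N) powr p')"
      using that p' by (simp add: powr_mult powr_powr mult.commute)
    finally show ?thesis
      using that p' by (subst Lp_norm_le_iff) auto
  qed
  show "Lp_norm M p' u \<le> ennreal ?C * Lp_norm M p u"
  proof (cases "Lp_norm M p u")
    case (real N)
    show ?thesis
    proof (rule ennreal_le_epsilon)
      fix e :: real assume "0 < e"
      then have "0 < N + e / ?C"
        using C real by (auto intro!: add_nonneg_pos)
      moreover have "Lp_norm M p u \<le> ennreal (N + e / ?C)"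
        using C real \<open>0 < e\<close> by (simp add: ennreal_leI)
      ultimately have "Lp_norm M p' u \<le> ennreal (?C * (N + e / ?C))"
        by (rule bound)
      also have "?C * (N + e / ?C) = ?C * N + e"
        using C by (simp add: distrib_left)
      also have "ennreal \<dots> = ennreal ?C * Lp_norm M p u + ennreal e"
        using C real \<open>0 < e\<close> by (simp add: ennreal_mult)
      finally show "Lp_norm M p' u \<le> ennreal ?C * Lp_norm M p u + ennreal e" .
    qed
  next
    case top
    then show ?thesis
      using C by (simp add: ennreal_mult_top ennreal_eq_0_iff not_le)
  qed
qed

text \<open>Uniform integrability: under a bound in \<open>L\<^sup>p\<close>, smallness in measure implies smallness in \<open>L\<^bsup>p'\<^esup>\<close>.
  The integral of \<open>|f|\<^bsup>p'\<^esup>\<close> is at most \<open>w\<^bsup>p'\<^esup> \<mu>(X) + T\<^bsup>p'\<^esup> \<mu>(B) + T\<^bsup>p'-p\<^esup> J\<^sup>p\<close>; the constants \<open>w\<close>, then \<open>T\<close>,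
  then \<open>b\<close> are chosen so that each summand is at most a third of \<open>\<epsilon>\<^bsup>p'\<^esup>\<close>.\<close>

lemma Lp_norm_le_of_small_in_measure:
  fixes M :: "'a measure"
  assumes fin: "emeasure M (space M) < \<infinity>" and p': "0 < p'" "p' < p" and "0 < \<epsilon>" "0 \<le> J"
  obtains w b where "0 < w" "0 < b"
    "\<And>f B. \<lbrakk>f \<in> borel_measurable M; Lp_norm M p f \<le> ennreal J; B \<in> sets M;
        emeasure M B \<le> ennreal b; \<And>x. x \<in> space M - B \<Longrightarrow> \<bar>f x\<bar> \<le> w\<rbrakk>
      \<Longrightarrow> Lp_norm M p' f \<le> ennreal \<epsilon>"
proof -
  define V where "V = measure M (space M)"
  have V: "emeasure M (space M) = ennreal V" "0 \<le> V"
    unfolding V_def using fin by (auto intro: emeasure_eq_ennreal_measure)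
  define e where "e = \<epsilon> powr p'"
  have e: "0 < e"
    using assms by (simp add: e_def)
  \<comment> \<open>The summands \<open>1\<close> in the denominators only guard against \<open>V = 0\<close> and \<open>J = 0\<close>.\<close>
  define w where "w = (e / (3 * (V + 1))) powr (1 / p')"
  define T where "T = (e / (3 * (J powr p + 1))) powr (1 / (p' - p))"
  define b where "b = e / (3 * T powr p')"
  have J: "0 < J powr p + 1"
    by (simp add: add_nonneg_pos)
  have pos: "0 < w" "0 < T" "0 < b"
    using e V J by (auto simp: w_def T_def b_def)
  have wV: "w powr p' * V \<le> e / 3"
  proof -
    have "w powr p' * V = e / 3 * (V / (V + 1))"
      using p' e V by (simp add: w_def powr_powr)
    also have "\<dots> \<le> e / 3"
      using e V by (intro mult_left_le) auto
    finally show ?thesis .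
  qed
  have TJ: "T powr (p' - p) * J powr p \<le> e / 3"
  proof -
    have "T powr (p' - p) = e / (3 * (J powr p + 1))"
      using p' e J by (simp add: T_def powr_powr)
    then have "T powr (p' - p) * J powr p = e / 3 * (J powr p / (J powr p + 1))"
      by simp
    also have "\<dots> \<le> e / 3"
      using e J by (intro mult_left_le) auto
    finally show ?thesis .
  qed
  have Tb: "T powr p' * b = e / 3"
    using pos by (simp add: b_def)
  show thesis
  proof (rule that[OF pos(1,3)])
    fix f :: "'a \<Rightarrow> real" and B
    assume f [measurable]: "f \<in> borel_measurable M" and fJ: "Lp_norm M p f \<le> ennreal J"
      and B [measurable]: "B \<in> sets M" and b: "emeasure M B \<le> ennreal b"
      and w: "\<And>x. x \<in> space M - B \<Longrightarrow> \<bar>f x\<bar> \<le> w"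
    let ?I = "\<integral>\<^sup>+ x. ennreal (\<bar>f x\<bar> powr p) \<partial>M"
    have "(\<integral>\<^sup>+ x. ennreal (\<bar>f x\<bar> powr p') \<partial>M)
      \<le> (\<integral>\<^sup>+ x. ennreal (w powr p') + (ennreal (T powr p') * indicator B x
            + ennreal (T powr (p' - p)) * ennreal (\<bar>f x\<bar> powr p)) \<partial>M)"
    proof (rule nn_integral_mono)
      fix x assume x: "x \<in> space M"
      show "ennreal (\<bar>f x\<bar> powr p') \<le> ennreal (w powr p') + (ennreal (T powr p') * indicator B x
            + ennreal (T powr (p' - p)) * ennreal (\<bar>f x\<bar> powr p))"
      proof (cases "x \<in> B")
        case True
        then show ?thesis
          using powr_le_add_powr[OF abs_ge_zero[of "f x"] pos(2) p']
          by (simp add: add_increasing flip: ennreal_mult ennreal_plus)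
      next
        case False
        then have "\<bar>f x\<bar> powr p' \<le> w powr p'"
          using w x p' by (intro powr_mono2) auto
        then show ?thesis
          by (intro add_increasing2) (auto simp: ennreal_leI)
      qed
    qed
    also have "\<dots> = ennreal (w powr p') * ennreal V + (ennreal (T powr p') * emeasure M B
        + ennreal (T powr (p' - p)) * ?I)"
      by (subst nn_integral_add, simp, simp, subst nn_integral_add)
        (auto simp: nn_integral_cmult V)
    also have "\<dots> \<le> ennreal (w powr p') * ennreal V + (ennreal (T powr p') * ennreal b
        + ennreal (T powr (p' - p)) * ennreal (J powr p))"
      using fJ p' \<open>0 \<le> J\<close> b
      by (intro add_left_mono mult_left_mono add_mono) (simp_all flip: Lp_norm_le_iff)
    also have "\<dots> = ennreal (w powr p' * V + (T powr p' * b + T powr (p' - p) * J powr p))"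
      using V pos by (simp flip: ennreal_mult ennreal_plus)
    also have "\<dots> \<le> ennreal (\<epsilon> powr p')"
      using wV TJ Tb by (intro ennreal_leI) (simp flip: e_def)
    finally show "Lp_norm M p' f \<le> ennreal \<epsilon>"
      using assms by (subst Lp_norm_le_iff) auto
  qed
qed

text \<open>A quasi-triangle inequality valid for every \<open>p > 0\<close>, from \<open>|a - b| \<le> 2 max(|a|, |b|)\<close>.\<close>

lemma Lp_norm_diff_le:
  assumes "0 < p" "0 \<le> R" and [measurable]: "u \<in> borel_measurable M" "v \<in> borel_measurable M"
    and "Lp_norm M p u \<le> ennreal R" "Lp_norm M p v \<le> ennreal R"
  shows "Lp_norm M p (\<lambda>x. u x - v x) \<le> ennreal (2 * 2 powr (1 / p) * R)"
proof -
  have pw: "\<bar>a - b\<bar> powr p \<le> 2 powr p * (\<bar>a\<bar> powr p + \<bar>b\<bar> powr p)" for a b :: real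
  proof -
    have "\<bar>a - b\<bar> powr p \<le> (2 * max \<bar>a\<bar> \<bar>b\<bar>) powr p"
      using assms(1) by (intro powr_mono2) auto
    also have "\<dots> = 2 powr p * max (\<bar>a\<bar> powr p) (\<bar>b\<bar> powr p)"
      by (auto simp: powr_mult max_def not_le dest: powr_mono2[OF less_imp_le[OF assms(1)] abs_ge_zero]
        intro: antisym powr_mono2[OF less_imp_le[OF assms(1)] abs_ge_zero less_imp_le])
    also have "\<dots> \<le> 2 powr p * (\<bar>a\<bar> powr p + \<bar>b\<bar> powr p)"
      by (intro mult_left_mono) auto
    finally show ?thesis .
  qed
  have "(\<integral>\<^sup>+ x. ennreal (\<bar>u x - v x\<bar> powr p) \<partial>M)
    \<le> (\<integral>\<^sup>+ x. ennreal (2 powr p) * (ennreal (\<bar>u x\<bar> powr p) + ennreal (\<bar>v x\<bar> powr p)) \<partial>M)"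
    using pw by (intro nn_integral_mono) (simp flip: ennreal_mult ennreal_plus)
  also have "\<dots> = ennreal (2 powr p) * ((\<integral>\<^sup>+ x. ennreal (\<bar>u x\<bar> powr p) \<partial>M)
      + (\<integral>\<^sup>+ x. ennreal (\<bar>v x\<bar> powr p) \<partial>M))"
    by (simp add: nn_integral_cmult nn_integral_add)
  also have "\<dots> \<le> ennreal (2 powr p) * (ennreal (R powr p) + ennreal (R powr p))"
    using assms by (intro mult_left_mono add_mono) (simp_all flip: Lp_norm_le_iff)
  also have "\<dots> = ennreal (2 powr p * (2 * R powr p))"
    by (simp flip: ennreal_mult ennreal_plus)
  also have "2 powr p * (2 * R powr p) = (2 * 2 powr (1 / p) * R) powr p"
    using assms by (simp add: powr_mult powr_powr)
  finally show ?thesis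
    using assms by (subst Lp_norm_le_iff) auto
qed

text \<open>Chebyshev's inequality.\<close>

lemma emeasure_superlevel_le:
  assumes "0 < p" "0 \<le> R" "0 < l" and [measurable]: "u \<in> borel_measurable M"
    and "Lp_norm M p u \<le> ennreal R"
  shows "emeasure M {x \<in> space M. l < \<bar>u x\<bar>} \<le> ennreal ((R / l) powr p)"
proof -
  let ?A = "{x \<in> space M. l < \<bar>u x\<bar>}"
  have "ennreal (l powr p) * emeasure M ?A = (\<integral>\<^sup>+ x. ennreal (l powr p) * indicator ?A x \<partial>M)"
    by (simp add: nn_integral_cmult)
  also have "\<dots> \<le> (\<integral>\<^sup>+ x. ennreal (\<bar>u x\<bar> powr p) \<partial>M)"
    using assms by (intro nn_integral_mono) (auto simp: indicator_def intro!: ennreal_leI powr_mono2)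
  also have "\<dots> \<le> ennreal (R powr p)"
    using assms by (simp flip: Lp_norm_le_iff)
  finally have "ennreal (1 / l powr p) * (ennreal (l powr p) * emeasure M ?A)
      \<le> ennreal (1 / l powr p) * ennreal (R powr p)"
    by (rule mult_left_mono) simp
  moreover have "ennreal (1 / l powr p) * (ennreal (l powr p) * emeasure M ?A) = emeasure M ?A"
    using assms by (simp flip: mult.assoc ennreal_mult)
  moreover have "ennreal (1 / l powr p) * ennreal (R powr p) = ennreal ((R / l) powr p)"
    using assms by (simp add: powr_divide flip: ennreal_mult)
  ultimately show ?thesis
    by simp
qed

section \<open>Covering a finite quasi-metric-measure space by finitely many balls\<close>

lemma quasi_metric_onE:
  assumes "quasi_metric_on X d"
  obtains C0 C1 where "0 < C0" "0 < C1"
    "\<And>x y. x \<in> X \<Longrightarrow> y \<in> X \<Longrightarrow> d y x \<le> C0 * d x y"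
    "\<And>x y z. x \<in> X \<Longrightarrow> y \<in> X \<Longrightarrow> z \<in> X \<Longrightarrow> d x y \<le> C1 * max (d x z) (d z y)"
proof -
  obtain C0 where C0: "C0 > 0" "\<forall>x\<in>X. \<forall>y\<in>X. d y x \<le> C0 * d x y"
    using assms unfolding quasi_metric_on_def by blast
  obtain C1 where C1: "C1 > 0" "\<forall>x\<in>X. \<forall>y\<in>X. \<forall>z\<in>X. d x y \<le> C1 * max (d x z) (d z y)"
    using assms unfolding quasi_metric_on_def by blast
  show thesis
    using C0 C1 by (intro that[of C0 C1]) auto
qed

lemma quasi_metric_on_nonneg: "quasi_metric_on X d \<Longrightarrow> x \<in> X \<Longrightarrow> y \<in> X \<Longrightarrow> 0 \<le> d x y"
  unfolding quasi_metric_on_def by blast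

lemma quasi_metric_on_eq_0_iff:
  "quasi_metric_on X d \<Longrightarrow> x \<in> X \<Longrightarrow> y \<in> X \<Longrightarrow> d x y = 0 \<longleftrightarrow> x = y"
  unfolding quasi_metric_on_def by blast

text \<open>Let \<open>X\<^sub>n\<close> be the set of centres whose ball of radius \<open>t\<close> has measure at least \<open>1/(n+1)\<close>. Separated subsets
  of \<open>X\<^sub>n\<close> have bounded size, so a largest one exists, and by maximality its \<open>s\<close>-balls cover \<open>X\<^sub>n\<close>. The sets
  \<open>X\<^sub>n\<close> may fail to be measurable, so it is the complements of these finite unions of balls that decrease
  to the empty set, and continuity from above applies to them.\<close>

lemma finitely_many_balls_cover:
  assumes qm: "quasi_metric_measure_space M d" and fin: "emeasure M (space M) < \<infinity>"
    and "0 < s" "0 < (b::real)"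
  obtains A where "finite A" "A \<subseteq> space M"
    "emeasure M (space M - (\<Union>x\<in>A. qball (space M) d x s)) \<le> ennreal b"
proof -
  interpret finite_measure M
    by (rule finite_measureI) (use fin in simp)
  have q: "quasi_metric_on (space M) d"
    using qm by (simp add: quasi_metric_measure_space_def)
  obtain C0 C1 where C: "0 < C0" "0 < C1"
    and sym: "\<And>x y. x \<in> space M \<Longrightarrow> y \<in> space M \<Longrightarrow> d y x \<le> C0 * d x y"
    and tri: "\<And>x y z. \<lbrakk>x \<in> space M; y \<in> space M; z \<in> space M\<rbrakk>
      \<Longrightarrow> d x y \<le> C1 * max (d x z) (d z y)"
    by (fact quasi_metric_onE[OF q])
  \<comment> \<open>As \<open>d\<close> is not symmetric, \<open>d y x < s'\<close> must already force \<open>d x y < s\<close>; and \<open>t\<close> is so small that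
    balls of radius \<open>t\<close> about \<open>s'\<close>-separated points cannot meet.\<close>
  define s' where "s' = s / (1 + C0)"
  define t where "t = s' / (2 * (C1 * (1 + C0)))"
  have s': "0 < s'" "s' \<le> s" "C0 * s' \<le> s"
    using C assms by (auto simp: s'_def field_simps)
  have t: "0 < t" "C1 * ((1 + C0) * t) < s'"
    using C s' by (auto simp: t_def)
  let ?B = "qball (space M) d"
  have ball: "?B x r \<in> sets M" "0 < measure M (?B x r)" if "x \<in> space M" "0 < r" for x r
    using qm that by (auto simp: quasi_metric_measure_space_def emeasure_eq_measure)
  define sep where "sep = (\<lambda>A. \<forall>x\<in>A. \<forall>y\<in>A. x \<noteq> y \<longrightarrow> s' \<le> d x y)"
  define X where "X = (\<lambda>n::nat. {x \<in> space M. 1 / (real n + 1) \<le> measure M (?B x t)})"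
  have disj: "?B x t \<inter> ?B y t = {}" if "x \<in> space M" "y \<in> space M" "s' \<le> d x y" for x y
  proof (rule ccontr)
    assume "?B x t \<inter> ?B y t \<noteq> {}"
    then obtain z where z: "z \<in> space M" "d x z < t" "d y z < t"
      by (auto simp: qball_def)
    have "d z y \<le> C0 * d y z"
      using sym that z by blast
    also have "\<dots> \<le> C0 * t"
      using C z by simp
    finally have "max (d x z) (d z y) \<le> (1 + C0) * t"
      using z t C by (simp add: distrib_right add_increasing add_increasing2)
    then have "d x y \<le> C1 * ((1 + C0) * t)"
      using tri[OF that(1,2) z(1)] C by (meson less_imp_le mult_left_mono order_trans)
    then show False
      using t that by simp
  qed
  \<comment> \<open>The balls of radius \<open>t\<close> about a separated set are disjoint, so the total mass bounds their number.\<close>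
  have card: "card A \<le> nat \<lceil>(real n + 1) * measure M (space M)\<rceil>"
    if "finite A" "A \<subseteq> X n" "sep A" for A n
  proof -
    have AM: "A \<subseteq> space M"
      using that by (auto simp: X_def)
    have "real (card A) * (1 / (real n + 1)) \<le> (\<Sum>x\<in>A. measure M (?B x t))"
      using that(2) by (intro sum_bounded_below) (auto simp: X_def)
    also have "\<dots> = measure M (\<Union>x\<in>A. ?B x t)"
    proof (rule finite_measure_finite_Union[symmetric, OF that(1)])
      show "(\<lambda>x. ?B x t) ` A \<subseteq> sets M"
        using AM ball t by blast
      show "disjoint_family_on (\<lambda>x. ?B x t) A"
        unfolding disjoint_family_on_def using that(3) AM disj sep_def by (metis subsetD)
    qed
    also have "\<dots> \<le> measure M (space M)"
      by (rule bounded_measure)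
    finally have "real (card A) \<le> (real n + 1) * measure M (space M)"
      by (simp add: field_simps)
    then show ?thesis
      by linarith
  qed
  have "\<exists>A. finite A \<and> A \<subseteq> X n \<and> X n \<subseteq> (\<Union>x\<in>A. ?B x s)" for n
  proof -
    let ?P = "\<lambda>A. finite A \<and> A \<subseteq> X n \<and> sep A"
    have "\<exists>A. ?P A \<and> (\<forall>A'. ?P A' \<longrightarrow> card A' \<le> card A)"
    proof (rule ex_has_greatest_nat[of ?P "{}"])
      show "?P {}"
        by (simp add: sep_def)
      show "\<forall>A'. ?P A' \<longrightarrow> card A' < Suc (nat \<lceil>(real n + 1) * measure M (space M)\<rceil>)"
        unfolding less_Suc_eq_le using card by blast
    qed
    then obtain A where A: "finite A" "A \<subseteq> X n" "sep A"
      and max: "\<And>A'. finite A' \<Longrightarrow> A' \<subseteq> X n \<Longrightarrow> sep A' \<Longrightarrow> card A' \<le> card A"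
      by blast
    have "y \<in> (\<Union>x\<in>A. ?B x s)" if y: "y \<in> X n" for y
    proof (rule ccontr)
      assume n: "y \<notin> (\<Union>x\<in>A. ?B x s)"
      have AM: "A \<subseteq> space M" and yM: "y \<in> space M"
        using A y by (auto simp: X_def)
      have "s \<le> d x y" if "x \<in> A" for x
        using n that yM by (auto simp: qball_def not_less)
      moreover have "s' \<le> d y x" if "x \<in> A" for x
      proof -
        have "C0 * s' \<le> s" "s \<le> d x y" "d x y \<le> C0 * d y x"
          using calculation[OF that] s' sym[of y x] AM that yM by auto
        then have "C0 * s' \<le> C0 * d y x"
          by linarith
        then show ?thesis
          using C by simp
      qed
      ultimately have "sep (insert y A)"
        using A(3) s'(2) unfolding sep_def by (metis insert_iff order_trans)
      then have "card (insert y A) \<le> card A"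
        using A y by (intro max) auto
      moreover have "y \<notin> A"
        using n yM assms(3) quasi_metric_on_eq_0_iff[OF q yM yM] unfolding qball_def by force
      ultimately show False
        using A by simp
    qed
    then show ?thesis
      using A by blast
  qed
  then obtain A where A: "\<And>n. finite (A n)" "\<And>n. A n \<subseteq> X n" "\<And>n. X n \<subseteq> (\<Union>x\<in>A n. ?B x s)"
    by metis
  have AM: "A n \<subseteq> space M" for n
    using A(2)[of n] by (auto simp: X_def)
  define A' where "A' = (\<lambda>n. \<Union>i\<le>n. A i)"
  define Z where "Z = (\<lambda>n. space M - (\<Union>x\<in>A' n. ?B x s))"
  have A': "finite (A' n)" "A' n \<subseteq> space M" for n
    unfolding A'_def using A(1) AM by blast+
  have "Z n \<in> sets M" for n
    unfolding Z_def using A'(2)[of n] assms(3)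
    by (intro sets.Diff sets.top sets.finite_UN[OF A'(1)] ball(1)) auto
  then have "range Z \<subseteq> sets M"
    by blast
  moreover have "decseq Z"
    unfolding decseq_def Z_def A'_def by (intro allI impI Diff_mono UN_mono) auto
  ultimately have "(\<lambda>n. emeasure M (Z n)) \<longlonglongrightarrow> emeasure M (\<Inter>n. Z n)"
    by (intro Lim_emeasure_decseq) auto
  moreover have "(\<Inter>n. Z n) = {}"
  proof -
    have "\<exists>n. x \<notin> Z n" if x: "x \<in> space M" for x
    proof -
      obtain n where "1 / (real n + 1) < measure M (?B x t)"
        using reals_Archimedean[OF ball(2)[OF x t(1)]] by (auto simp: inverse_eq_divide add.commute)
      then have "x \<in> X n"
        using x by (simp add: X_def)
      then have "x \<in> (\<Union>x\<in>A n. ?B x s)"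
        using A(3) by blast
      then have "x \<notin> Z n"
        unfolding Z_def A'_def by blast
      then show ?thesis ..
    qed
    then show ?thesis
      by (auto simp: Z_def)
  qed
  ultimately have "(\<lambda>n. emeasure M (Z n)) \<longlonglongrightarrow> 0"
    by simp
  then have "eventually (\<lambda>n. emeasure M (Z n) < ennreal b) sequentially"
    using assms by (intro order_tendstoD) auto
  then obtain n where "emeasure M (Z n) < ennreal b"
    by (auto simp: eventually_sequentially)
  then show thesis
    using that[OF A'[of n]] by (simp add: Z_def)
qed

section \<open>Compactness on spaces of finite measure\<close>

lemma dyadic_scale:
  assumes "0 < (t::real)"
  obtains k :: int where "2 powi (- k - 1) \<le> t" "t < 2 powi (- k)"
proof
  let ?k = "- \<lfloor>log 2 t\<rfloor> - 1"
  have "2 powr of_int (- ?k - 1) \<le> t"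
    using assms by (simp add: le_log_iff[symmetric])
  then show "2 powi (- ?k - 1) \<le> t"
    by (subst (asm) powr_real_of_int') auto
  have "t < 2 powr of_int (- ?k)"
    using assms real_of_int_floor_add_one_gt[of "log 2 t"]
    by (simp add: log_less_iff[symmetric] add.commute)
  then show "t < 2 powi (- ?k)"
    by (subst (asm) powr_real_of_int') auto
qed

text \<open>The exceptional set consists of the null set of the gradient, of \<open>{|u| > l}\<close>, and of
  \<open>{g\<^sub>k > \<eta> 2\<^bsup>k\<alpha>\<^esup>}\<close> for all \<open>k \<ge> m\<close>. By Chebyshev the last sets have total measure at most
  \<open>\<Sum>\<^sub>k (R / (\<eta> 2\<^bsup>k\<alpha>\<^esup>))\<^sup>p\<close>, a geometric tail that depends on \<open>m\<close> but not on \<open>u\<close>. Off them, a pair at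
  distance in \<open>[2\<^bsup>-k-1\<^esup>, 2\<^bsup>-k\<^esup>)\<close> satisfies \<open>|u(x) - u(y)| \<le> 2\<^bsup>-k\<alpha>\<^esup> \<cdot> 2 \<eta> 2\<^bsup>k\<alpha>\<^esup>\<close>.\<close>

lemma uniform_oscillation_bound:
  fixes M :: "'a measure"
  assumes q: "quasi_metric_on (space M) d" and pos: "0 < p" "0 < \<alpha>" "0 \<le> R" "0 < \<eta>" "0 < (b::real)"
  obtains l :: real and m :: nat where "0 < l"
    "\<And>u g. \<lbrakk>u \<in> borel_measurable M; Lp_norm M p u \<le> ennreal R;
        g \<in> fractional_gradients M d \<alpha> u; \<And>k. Lp_norm M p (g k) \<le> ennreal R\<rbrakk>
      \<Longrightarrow> \<exists>B\<in>sets M. emeasure M B \<le> ennreal b \<and> (\<forall>x\<in>space M - B. \<bar>u x\<bar> \<le> l) \<and>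
        (\<forall>x\<in>space M - B. \<forall>y\<in>space M - B. d x y < 1 / 2 ^ m \<longrightarrow> \<bar>u x - u y\<bar> \<le> 2 * \<eta>)"
proof -
  \<comment> \<open>\<open>R + 1\<close> instead of \<open>R\<close> keeps the level positive.\<close>
  define l where "l = (R + 1) / (b / 2) powr (1 / p)"
  have l: "0 < l"
    using pos by (simp add: l_def)
  have Rl: "(R / l) powr p \<le> b / 2"
  proof -
    have "R / l = R / (R + 1) * (b / 2) powr (1 / p)"
      by (simp add: l_def)
    also have "\<dots> \<le> (b / 2) powr (1 / p)"
      using pos by (intro mult_left_le_one_le) auto
    finally have "(R / l) powr p \<le> ((b / 2) powr (1 / p)) powr p"
      using pos l by (intro powr_mono2) auto
    then show ?thesis
      using pos by (simp add: powr_powr)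
  qed
  define y where "y = 2 powr (- (\<alpha> * p))"
  have y: "0 < y" "y < 1"
    using pos by (auto simp: y_def powr_less_one)
  define D where "D = (R / \<eta>) powr p / (1 - y)"
  have D: "0 \<le> D"
    using y by (simp add: D_def)
  obtain m where "y ^ m < (b / 2) / (D + 1)"
    using real_arch_pow_inv[of "(b / 2) / (D + 1)" y] y D pos by auto
  then have "D * y ^ m \<le> b / 2"
    using D y by (simp add: field_simps) (smt (verit) mult_nonneg_nonneg zero_less_power)
  moreover define f where "f = (\<lambda>n. (R / (\<eta> * 2 powr (real (m + n) * \<alpha>))) powr p)"
  have f: "f n = (R / \<eta>) powr p * y ^ m * y ^ n" for n
  proof -
    have "f n = (R / \<eta>) powr p / 2 powr (real (m + n) * \<alpha> * p)"
      using pos by (simp add: f_def powr_divide powr_mult powr_powr)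
    also have "\<dots> = (R / \<eta>) powr p * 2 powr (- (\<alpha> * p) * real (m + n))"
      by (simp add: powr_minus_divide mult_ac)
    also have "2 powr (- (\<alpha> * p) * real (m + n)) = y ^ (m + n)"
      using y by (simp add: y_def powr_powr flip: powr_realpow)
    finally show ?thesis
      by (simp add: power_add)
  qed
  have "f sums ((R / \<eta>) powr p * y ^ m * (1 / (1 - y)))"
    unfolding f using y by (intro sums_mult geometric_sums) auto
  then have "f sums (D * y ^ m)"
    by (simp add: D_def mult_ac)
  ultimately have f_sum: "(\<Sum>n. ennreal (f n)) \<le> ennreal (b / 2)"
    by (subst suminf_ennreal_eq) (auto simp: f_def ennreal_leI)
  show thesis
  proof (rule that[OF l])
    fix u :: "'a \<Rightarrow> real" and g
    assume u [measurable]: "u \<in> borel_measurable M" and uR: "Lp_norm M p u \<le> ennreal R"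
      and g: "g \<in> fractional_gradients M d \<alpha> u" and gR: "\<And>k. Lp_norm M p (g k) \<le> ennreal R"
    have [measurable]: "g k \<in> borel_measurable M" for k
      using g by (simp add: fractional_gradients_def)
    obtain E where E [measurable]: "E \<in> null_sets M"
      and Eg: "\<And>k x y. \<lbrakk>x \<in> space M - E; y \<in> space M - E; 2 powi (- k - 1) \<le> d x y;
        d x y < 2 powi (- k)\<rbrakk> \<Longrightarrow> \<bar>u x - u y\<bar> \<le> d x y powr \<alpha> * (g k x + g k y)"
      using g by (auto simp: fractional_gradients_def)
    define U where "U = {x \<in> space M. l < \<bar>u x\<bar>}"
    define G where "G = (\<lambda>n. {x \<in> space M. \<eta> * 2 powr (real (m + n) * \<alpha>) < \<bar>g (int (m + n)) x\<bar>})"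
    have [measurable]: "U \<in> sets M" "G n \<in> sets M" "E \<in> sets M" for n
      using E unfolding U_def G_def by auto
    let ?B = "E \<union> U \<union> (\<Union>n. G n)"
    show "\<exists>B\<in>sets M. emeasure M B \<le> ennreal b \<and> (\<forall>x\<in>space M - B. \<bar>u x\<bar> \<le> l) \<and>
        (\<forall>x\<in>space M - B. \<forall>y\<in>space M - B. d x y < 1 / 2 ^ m \<longrightarrow> \<bar>u x - u y\<bar> \<le> 2 * \<eta>)"
    proof (intro bexI[of _ ?B] conjI ballI impI)
      have "emeasure M U \<le> ennreal (b / 2)"
        unfolding U_def by (rule order_trans[OF emeasure_superlevel_le[OF pos(1,3) l u uR] ennreal_leI[OF Rl]])
      moreover have "emeasure M (\<Union>n. G n) \<le> ennreal (b / 2)"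
      proof -
        have "emeasure M (\<Union>n. G n) \<le> (\<Sum>n. emeasure M (G n))"
          by (intro emeasure_subadditive_countably) auto
        also have "\<dots> \<le> (\<Sum>n. ennreal (f n))"
          unfolding G_def f_def using pos
          by (intro suminf_le emeasure_superlevel_le gR) auto
        finally show ?thesis
          using f_sum by simp
      qed
      ultimately have "emeasure M U + emeasure M (\<Union>n. G n) \<le> ennreal (b / 2) + ennreal (b / 2)"
        by (rule add_mono)
      moreover have "emeasure M ?B \<le> emeasure M E + emeasure M U + emeasure M (\<Union>n. G n)"
        by (intro order_trans[OF emeasure_subadditive] add_right_mono emeasure_subadditive) auto
      ultimately show "emeasure M ?B \<le> ennreal b"
        using pos E by (simp add: null_setsD1 flip: ennreal_plus)
    next
      fix x assume "x \<in> space M - ?B"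
      then show "\<bar>u x\<bar> \<le> l"
        by (auto simp: U_def)
    next
      fix x z assume x: "x \<in> space M - ?B" and z: "z \<in> space M - ?B" and less: "d x z < 1 / 2 ^ m"
      show "\<bar>u x - u z\<bar> \<le> 2 * \<eta>"
      proof (cases "x = z")
        case True
        then show ?thesis
          using pos by simp
      next
        case False
        then have dpos: "0 < d x z"
          using quasi_metric_on_nonneg[OF q, of x z] quasi_metric_on_eq_0_iff[OF q, of x z] x z by auto
        then obtain k :: int where k: "2 powi (- k - 1) \<le> d x z" "d x z < 2 powi (- k)"
          by (rule dyadic_scale)
        have small: "(2::real) powi (- k - 1) < 2 powi (- int m)"
          using k less by (simp add: power_int_minus divide_inverse)
        have "int m \<le> k"
        proof (rule ccontr)
          assume "\<not> int m \<le> k"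
          then have "(2::real) powi (- int m) \<le> 2 powi (- k - 1)"
            by (intro power_int_increasing) auto
          then show False
            using small by simp
        qed
        then obtain n where "k - int m = int n"
          using zero_le_imp_eq_int[of "k - int m"] by auto
        then have n: "k = int (m + n)"
          by simp
        let ?e = "\<eta> * 2 powr (real (m + n) * \<alpha>)"
        have "g k x \<le> ?e" "g k z \<le> ?e"
          using x z n by (auto simp: G_def not_less abs_le_iff)
        then have "\<bar>u x - u z\<bar> \<le> d x z powr \<alpha> * (2 * ?e)"
          using Eg[OF _ _ k] x z by (smt (verit) DiffE DiffI UnI1 mult_left_mono powr_ge_zero)
        also have "\<dots> \<le> (2 powr (- real (m + n))) powr \<alpha> * (2 * ?e)"
        proof (intro mult_right_mono powr_mono2)
          show "d x z \<le> 2 powr - real (m + n)"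
            using k(2) powr_real_of_int'[of 2 "- k"] n by simp
        qed (use pos dpos in auto)
        also have "\<dots> = 2 * \<eta> * 2 powr (- (real (m + n) * \<alpha>) + real (m + n) * \<alpha>)"
          by (simp only: powr_powr powr_add mult_minus_left mult_minus_right mult_ac)
        also have "\<dots> = 2 * \<eta>"
          by simp
        finally show ?thesis .
      qed
    qed auto
  qed
qed

text \<open>Total boundedness in measure. The code of \<open>u\<close> records, for each ball of a finite family covering up to
  small measure, the value of \<open>u\<close> at one good point of the ball, rounded to a multiple of \<open>\<eta>\<close>. There are
  finitely many codes because \<open>|u| \<le> l\<close> at good points. If two functions share a code, then at a point that is
  good for both they differ by at most \<open>2\<eta> + \<eta> + 2\<eta> = w\<close>. Balls without good points get the irrelevant code \<open>0\<close>.\<close>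

lemma finite_net_in_measure:
  fixes M :: "'a measure"
  assumes qm: "quasi_metric_measure_space M d" and fin: "emeasure M (space M) < \<infinity>"
    and pos: "0 < p" "0 < \<alpha>" "0 \<le> R" "0 < w" "0 < (b::real)"
    and S: "S \<subseteq> borel_measurable M" "\<And>u. u \<in> S \<Longrightarrow> Lp_norm M p u \<le> ennreal R"
      "\<And>u. u \<in> S \<Longrightarrow> \<exists>g\<in>fractional_gradients M d \<alpha> u. \<forall>k. Lp_norm M p (g k) \<le> ennreal R"
  shows "\<exists>F. finite F \<and> F \<subseteq> S \<and> (\<forall>u\<in>S. \<exists>v\<in>F. \<exists>B\<in>sets M. emeasure M B \<le> ennreal b \<and>
      (\<forall>x\<in>space M - B. \<bar>u x - v x\<bar> \<le> w))"
proof -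
  have q: "quasi_metric_on (space M) d"
    using qm by (simp add: quasi_metric_measure_space_def)
  obtain C0 C1 where C: "0 < C0" "0 < C1"
    and sym: "\<And>x y. x \<in> space M \<Longrightarrow> y \<in> space M \<Longrightarrow> d y x \<le> C0 * d x y"
    and tri: "\<And>x y z. \<lbrakk>x \<in> space M; y \<in> space M; z \<in> space M\<rbrakk>
      \<Longrightarrow> d x y \<le> C1 * max (d x z) (d z y)"
    by (fact quasi_metric_onE[OF q])
  define \<eta> where "\<eta> = w / 5"
  have \<eta>: "0 < \<eta>"
    using pos by (simp add: \<eta>_def)
  have b3: "0 < b / 3"
    using pos by simp
  obtain l m where "0 < l" and osc: "\<And>u g. \<lbrakk>u \<in> borel_measurable M; Lp_norm M p u \<le> ennreal R;
        g \<in> fractional_gradients M d \<alpha> u; \<And>k. Lp_norm M p (g k) \<le> ennreal R\<rbrakk>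
      \<Longrightarrow> \<exists>B\<in>sets M. emeasure M B \<le> ennreal (b / 3) \<and> (\<forall>x\<in>space M - B. \<bar>u x\<bar> \<le> l) \<and>
        (\<forall>x\<in>space M - B. \<forall>y\<in>space M - B. d x y < 1 / 2 ^ m \<longrightarrow> \<bar>u x - u y\<bar> \<le> 2 * \<eta>)"
    by (fact uniform_oscillation_bound[OF q pos(1-3) \<eta> b3])
  have "\<exists>B. \<forall>u\<in>S. B u \<in> sets M \<and> emeasure M (B u) \<le> ennreal (b / 3) \<and>
      (\<forall>x\<in>space M - B u. \<bar>u x\<bar> \<le> l) \<and>
      (\<forall>x\<in>space M - B u. \<forall>y\<in>space M - B u. d x y < 1 / 2 ^ m \<longrightarrow> \<bar>u x - u y\<bar> \<le> 2 * \<eta>)"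
  proof (intro bchoice ballI)
    fix u assume u: "u \<in> S"
    then obtain g where "g \<in> fractional_gradients M d \<alpha> u" "\<And>k. Lp_norm M p (g k) \<le> ennreal R"
      using S(3) by blast
    from osc[OF subsetD[OF S(1) u] S(2)[OF u] this]
    show "\<exists>B. B \<in> sets M \<and> emeasure M B \<le> ennreal (b / 3) \<and> (\<forall>x\<in>space M - B. \<bar>u x\<bar> \<le> l) \<and>
      (\<forall>x\<in>space M - B. \<forall>y\<in>space M - B. d x y < 1 / 2 ^ m \<longrightarrow> \<bar>u x - u y\<bar> \<le> 2 * \<eta>)"
      unfolding Bex_def .
  qed
  then obtain B where B: "\<And>u. u \<in> S \<Longrightarrow> B u \<in> sets M"
      "\<And>u. u \<in> S \<Longrightarrow> emeasure M (B u) \<le> ennreal (b / 3)"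
      "\<And>u x. u \<in> S \<Longrightarrow> x \<in> space M - B u \<Longrightarrow> \<bar>u x\<bar> \<le> l"
      "\<And>u x y. \<lbrakk>u \<in> S; x \<in> space M - B u; y \<in> space M - B u; d x y < 1 / 2 ^ m\<rbrakk>
        \<Longrightarrow> \<bar>u x - u y\<bar> \<le> 2 * \<eta>"
    by blast
  \<comment> \<open>Two points of a ball of radius \<open>s\<close> are at distance less than \<open>2\<^bsup>-m\<^esup>\<close>.\<close>
  define s where "s = 1 / 2 ^ m / (2 * (C1 * (1 + C0)))"
  have s: "0 < s" "C1 * ((1 + C0) * s) < 1 / 2 ^ m"
  proof -
    have "C1 * ((1 + C0) * s) = 1 / 2 ^ m / 2"
      using C add_pos_pos[of 1 C0] by (simp add: s_def)
    also have "\<dots> < 1 / 2 ^ m"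
      by (simp add: divide_less_eq)
    finally show "C1 * ((1 + C0) * s) < 1 / 2 ^ m" .
  qed (use C in \<open>simp add: s_def\<close>)
  let ?P = "\<lambda>a. qball (space M) d a s"
  have small: "d x y < 1 / 2 ^ m" if "a \<in> space M" "x \<in> ?P a" "y \<in> ?P a" for a x y
  proof -
    have xy: "x \<in> space M" "y \<in> space M" "d a x < s" "d a y < s"
      using that by (auto simp: qball_def)
    have "d x a \<le> C0 * d a x"
      using sym that xy by blast
    also have "\<dots> \<le> C0 * s"
      using C xy by simp
    finally have "max (d x a) (d a y) \<le> (1 + C0) * s"
      using xy s C by (simp add: distrib_right add_increasing add_increasing2)
    then have "d x y \<le> C1 * ((1 + C0) * s)"
      using tri[OF xy(1,2) that(1)] C by (meson less_imp_le mult_left_mono order_trans)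
    then show ?thesis
      using s by simp
  qed
  obtain A where A: "finite A" "A \<subseteq> space M"
    and rest: "emeasure M (space M - (\<Union>x\<in>A. ?P x)) \<le> ennreal (b / 3)"
    by (rule finitely_many_balls_cover[OF qm fin s(1) b3])
  let ?Z = "space M - (\<Union>x\<in>A. ?P x)"
  have Z: "?Z \<in> sets M"
    using qm A s(1) unfolding quasi_metric_measure_space_def
    by (intro sets.Diff sets.top sets.finite_UN) blast+
  define pt where "pt = (\<lambda>u a. SOME x. x \<in> ?P a - B u)"
  have pt: "pt u a \<in> ?P a - B u" if "x \<in> ?P a - B u" for u a x
    unfolding pt_def using that by (rule someI)
  define code where "code = (\<lambda>u. \<lambda>a\<in>A. if ?P a - B u = {} then 0 else \<lfloor>u (pt u a) / \<eta>\<rfloor>)"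
  have "code ` S \<subseteq> (\<Pi>\<^sub>E a\<in>A. {- \<lceil>l / \<eta>\<rceil>..\<lceil>l / \<eta>\<rceil>})"
  proof
    fix c assume "c \<in> code ` S"
    then obtain u where u: "u \<in> S" "c = code u"
      by blast
    have "\<lfloor>u (pt u a) / \<eta>\<rfloor> \<in> {- \<lceil>l / \<eta>\<rceil>..\<lceil>l / \<eta>\<rceil>}" if "?P a - B u \<noteq> {}" for a
    proof -
      have "pt u a \<in> space M - B u"
        using that pt by (force simp: qball_def)
      then have "\<bar>u (pt u a)\<bar> \<le> l"
        using B(3) u by blast
      then have "u (pt u a) / \<eta> \<le> l / \<eta>" "- (l / \<eta>) \<le> u (pt u a) / \<eta>"
        using \<eta> by (auto simp: field_simps abs_le_iff)
      then show ?thesis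
        by (auto simp: le_floor_iff) linarith+
    qed
    moreover have "0 \<in> {- \<lceil>l / \<eta>\<rceil>..\<lceil>l / \<eta>\<rceil>}"
      using \<open>0 < l\<close> \<eta> by (auto simp: le_ceiling_iff intro: order_less_trans[of _ 0])
    ultimately show "c \<in> (\<Pi>\<^sub>E a\<in>A. {- \<lceil>l / \<eta>\<rceil>..\<lceil>l / \<eta>\<rceil>})"
      using u by (auto simp: code_def)
  qed
  then have "finite (code ` S)"
    by (rule finite_subset) (use A in \<open>auto intro: finite_PiE\<close>)
  then obtain F where F: "F \<subseteq> S" "finite F" "code ` S = code ` F"
    using finite_subset_image[of "code ` S" code S] by auto
  show ?thesis
  proof (intro exI[of _ F] conjI F ballI)
    fix u assume u: "u \<in> S"
    then obtain v where v: "v \<in> F" "code u = code v"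
      using F by (metis imageE imageI)
    then have vS: "v \<in> S"
      using F by blast
    let ?N = "?Z \<union> B u \<union> B v"
    have "emeasure M ?N \<le> emeasure M ?Z + emeasure M (B u) + emeasure M (B v)"
      using Z B(1) u vS
      by (intro order_trans[OF emeasure_subadditive] add_right_mono emeasure_subadditive) auto
    also have "\<dots> \<le> ennreal (b / 3) + ennreal (b / 3) + ennreal (b / 3)"
      using rest B(2) u vS by (intro add_mono)
    also have "\<dots> = ennreal b"
      using pos by (simp flip: ennreal_plus)
    finally have "emeasure M ?N \<le> ennreal b" .
    moreover have "\<bar>u x - v x\<bar> \<le> w" if x: "x \<in> space M - ?N" for x
    proof -
      obtain a where a: "a \<in> A" "x \<in> ?P a"
        using x by blast
      have aM: "a \<in> space M"
        using a A by blast
      have xu: "x \<in> ?P a - B u" and xv: "x \<in> ?P a - B v"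
        using x a by auto
      have pu: "pt u a \<in> ?P a - B u" and pv: "pt v a \<in> ?P a - B v"
        using pt xu xv by blast+
      have PM: "?P a \<subseteq> space M"
        by (auto simp: qball_def)
      have "\<bar>u x - u (pt u a)\<bar> \<le> 2 * \<eta>"
        using PM x pu a small[OF aM] by (intro B(4) u) auto
      moreover have "\<bar>v x - v (pt v a)\<bar> \<le> 2 * \<eta>"
        using PM x pv a small[OF aM] by (intro B(4) vS) auto
      moreover have "\<bar>u (pt u a) - v (pt v a)\<bar> \<le> \<eta>"
      proof -
        have "?P a - B u \<noteq> {}" "?P a - B v \<noteq> {}"
          using xu xv by blast+
        then have "\<lfloor>u (pt u a) / \<eta>\<rfloor> = \<lfloor>v (pt v a) / \<eta>\<rfloor>"
          using fun_cong[OF v(2), of a] a by (simp add: code_def)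
        then have "\<bar>u (pt u a) / \<eta> - v (pt v a) / \<eta>\<bar> \<le> 1"
          by linarith
        then have "\<bar>u (pt u a) - v (pt v a)\<bar> / \<eta> \<le> 1"
          using \<eta> by (simp flip: diff_divide_distrib)
        then show ?thesis
          using \<eta> by simp
      qed
      ultimately show ?thesis
        unfolding \<eta>_def by linarith
    qed
    ultimately show "\<exists>v\<in>F. \<exists>B\<in>sets M. emeasure M B \<le> ennreal b \<and>
      (\<forall>x\<in>space M - B. \<bar>u x - v x\<bar> \<le> w)"
      using v Z B(1) u vS by (intro bexI[of _ v] bexI[of _ ?N]) auto
  qed
qed

lemma totally_bounded_in_Lp:
  fixes M :: "'a measure"
  assumes qm: "quasi_metric_measure_space M d" and fin: "emeasure M (space M) < \<infinity>"
    and pos: "0 < p'" "p' < p" "0 < \<alpha>" "0 \<le> R"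
    and S: "S \<subseteq> borel_measurable M" "\<And>u. u \<in> S \<Longrightarrow> Lp_norm M p u \<le> ennreal R"
      "\<And>u. u \<in> S \<Longrightarrow> \<exists>g\<in>fractional_gradients M d \<alpha> u. \<forall>k. Lp_norm M p (g k) \<le> ennreal R"
  shows "norm_totally_bounded (Lp_norm M p') S"
  unfolding norm_totally_bounded_def
proof (intro allI impI)
  fix \<epsilon> :: real assume \<epsilon>: "0 < \<epsilon>"
  have p: "0 < p" and J: "0 \<le> 2 * 2 powr (1 / p) * R" and \<epsilon>2: "0 < \<epsilon> / 2"
    using pos \<epsilon> by auto
  obtain w b where wb: "0 < w" "0 < b" and small:
    "\<And>f B. \<lbrakk>f \<in> borel_measurable M; Lp_norm M p f \<le> ennreal (2 * 2 powr (1 / p) * R);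
        B \<in> sets M; emeasure M B \<le> ennreal b; \<And>x. x \<in> space M - B \<Longrightarrow> \<bar>f x\<bar> \<le> w\<rbrakk>
      \<Longrightarrow> Lp_norm M p' f \<le> ennreal (\<epsilon> / 2)"
    by (fact Lp_norm_le_of_small_in_measure[OF fin pos(1,2) \<epsilon>2 J])
  obtain F where F: "finite F" "F \<subseteq> S" and net:
    "\<forall>u\<in>S. \<exists>v\<in>F. \<exists>B\<in>sets M. emeasure M B \<le> ennreal b \<and>
      (\<forall>x\<in>space M - B. \<bar>u x - v x\<bar> \<le> w)"
    using finite_net_in_measure[OF qm fin p pos(3,4) wb S(1) S(2) S(3)] by auto
  have "\<exists>v\<in>F. Lp_norm M p' (\<lambda>x. u x - v x) < ennreal \<epsilon>" if u: "u \<in> S" for u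
  proof -
    obtain v B where v: "v \<in> F" and B: "B \<in> sets M" "emeasure M B \<le> ennreal b"
        "\<forall>x\<in>space M - B. \<bar>u x - v x\<bar> \<le> w"
      using bspec[OF net u] by blast
    have [measurable]: "u \<in> borel_measurable M" "v \<in> borel_measurable M"
      using S(1) F(2) u v by auto
    have "Lp_norm M p' (\<lambda>x. u x - v x) \<le> ennreal (\<epsilon> / 2)"
      using B F(2) S(2) u v pos p by (intro small[of _ B] Lp_norm_diff_le) auto
    also have "\<dots> < ennreal \<epsilon>"
      using \<epsilon> by (simp add: ennreal_less_iff)
    finally show ?thesis
      using v by blast
  qed
  then show "\<exists>F. finite F \<and> F \<subseteq> S \<and> (\<forall>u\<in>S. \<exists>v\<in>F. Lp_norm M p' (\<lambda>x. u x - v x) < ennreal \<epsilon>)"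
    using F by blast
qed

text \<open>Common to both scales of spaces: only a gradient bound that is uniform over norm-bounded sets is needed.\<close>

lemma compact_embedding_of_finite_measure:
  fixes M :: "'a measure"
  assumes qm: "quasi_metric_measure_space M d" and fin: "emeasure M (space M) < \<infinity>"
    and pos: "0 < p'" "p' < p" "0 < \<alpha>"
    and A: "A \<subseteq> Lp_space M p" "\<And>u. u \<in> A \<Longrightarrow> Lp_norm M p u \<le> nA u"
    and grad: "\<And>R. \<exists>R'. \<forall>u\<in>A. nA u \<le> ennreal R \<longrightarrow>
      (\<exists>g\<in>fractional_gradients M d \<alpha> u. \<forall>k. Lp_norm M p (g k) \<le> ennreal R')"
  shows "compact_embedding A nA (Lp_space M p') (Lp_norm M p')"
  unfolding compact_embedding_def continuous_embedding_def
proof (intro conjI allI impI)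
  obtain C where C: "0 < C"
    and le: "\<And>u. u \<in> borel_measurable M \<Longrightarrow> Lp_norm M p' u \<le> ennreal C * Lp_norm M p u"
    using continuous_embedding_Lp[OF fin pos(1,2)] by blast
  have "Lp_norm M p' u \<le> ennreal C * nA u" if "u \<in> A" for u
  proof -
    have "u \<in> borel_measurable M"
      using A(1) that by (auto simp: Lp_space_def)
    from order_trans[OF le[OF this] mult_left_mono[OF A(2)[OF that]]] show ?thesis
      by simp
  qed
  then show "\<exists>C\<ge>0. \<forall>u\<in>A. Lp_norm M p' u \<le> ennreal C * nA u"
    using C by (intro exI[of _ C]) auto
  show "A \<subseteq> Lp_space M p'"
  proof
    fix u assume "u \<in> A"
    then have u: "u \<in> borel_measurable M" "Lp_norm M p u < \<infinity>"
      using A(1) by (auto simp: Lp_space_def)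
    have "ennreal C * Lp_norm M p u < \<infinity>"
      using u(2) by (simp add: ennreal_mult_less_top)
    then show "u \<in> Lp_space M p'"
      using le_less_trans[OF le[OF u(1)]] u(1) by (simp add: Lp_space_def)
  qed
next
  fix S assume S: "S \<subseteq> A" "\<exists>R. \<forall>u\<in>S. nA u \<le> ennreal R"
  then obtain R where R: "\<And>u. u \<in> S \<Longrightarrow> nA u \<le> ennreal R"
    by blast
  obtain R' where R': "\<And>u. u \<in> A \<Longrightarrow> nA u \<le> ennreal R \<Longrightarrow>
      \<exists>g\<in>fractional_gradients M d \<alpha> u. \<forall>k. Lp_norm M p (g k) \<le> ennreal R'"
    using grad by blast
  let ?R = "max 0 (max R R')"
  have mono: "ennreal R \<le> ennreal ?R" "ennreal R' \<le> ennreal ?R"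
    by (auto intro: ennreal_leI)
  show "norm_totally_bounded (Lp_norm M p') S"
  proof (rule totally_bounded_in_Lp[OF qm fin pos])
    show "S \<subseteq> borel_measurable M"
      using S A by (auto simp: Lp_space_def)
    show "Lp_norm M p u \<le> ennreal ?R" if "u \<in> S" for u
      using A(2)[of u] R[of u] S that mono by (meson order_trans subsetD)
    show "\<exists>g\<in>fractional_gradients M d \<alpha> u. \<forall>k. Lp_norm M p (g k) \<le> ennreal ?R" if "u \<in> S" for u
      using R'[of u] R[of u] S that mono by (meson order_trans subsetD)
  qed simp
qed

section \<open>Chains and Hoelder continuous gauges\<close>

text \<open>Frink's chain lemma. Let \<open>r\<close> be the last index with \<open>\<delta>(x\<^sub>i,x\<^sub>j) \<le> 2 \<delta>(x\<^sub>r,x\<^sub>j)\<close>. Unless \<open>r\<close> is an end of the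
  range, where an end link alone suffices, \<open>r + 1\<close> fails this, and the
  quasi-ultrametric inequality through \<open>x\<^bsub>r+1\<^esub>\<close> gives \<open>\<delta>(x\<^sub>i,x\<^sub>j) \<le> 2 \<delta>(x\<^sub>i,x\<^bsub>r+1\<^esub>)\<close>. Averaging the two,
  \<open>\<delta>(x\<^sub>i,x\<^sub>j) \<le> \<delta>(x\<^sub>i,x\<^bsub>r+1\<^esub>) + \<delta>(x\<^sub>r,x\<^sub>j)\<close>, and induction applies to both chains. These overlap in the link
  from \<open>r\<close> to \<open>r + 1\<close>; the credit for the end links pays for counting it twice, which is why a bare
  bound by \<open>4\<close> times the sum would not survive the induction.\<close>

lemma chain_inequality:
  fixes \<delta> :: "'a \<Rightarrow> 'a \<Rightarrow> real" and x :: "nat \<Rightarrow> 'a"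
  assumes nonneg: "\<And>a b. a \<in> X \<Longrightarrow> b \<in> X \<Longrightarrow> 0 \<le> \<delta> a b"
    and tri: "\<And>a b c. a \<in> X \<Longrightarrow> b \<in> X \<Longrightarrow> c \<in> X \<Longrightarrow> \<delta> a b \<le> 2 * max (\<delta> a c) (\<delta> c b)"
    and x: "\<And>k. x k \<in> X" and "i + 2 \<le> j"
  shows "\<delta> (x i) (x j) + 2 * \<delta> (x i) (x (Suc i)) + 2 * \<delta> (x (j - 1)) (x j)
    \<le> 4 * (\<Sum>k=i..<j. \<delta> (x k) (x (Suc k)))"
  using assms(4)
proof (induction "j - i" arbitrary: i j rule: less_induct)
  case less
  let ?e = "\<lambda>k. \<delta> (x k) (x (Suc k))"
  let ?D = "\<delta> (x i) (x j)"
  have e: "0 \<le> ?e k" for k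
    using nonneg x by blast
  have last: "\<delta> (x (j - 1)) (x j) = ?e (j - 1)"
    using less.prems by simp
  have "(\<Sum>k=i..<j. ?e k) = ?e i + (\<Sum>k=Suc i..<j. ?e k)"
    using less.prems by (intro sum.atLeast_Suc_lessThan) simp
  moreover have "?e (j - 1) \<le> (\<Sum>k=Suc i..<j. ?e k)"
    using less.prems e by (intro member_le_sum) auto
  ultimately have ends: "?e i + ?e (j - 1) \<le> (\<Sum>k=i..<j. ?e k)"
    by linarith
  define H where "H = {r \<in> {i..<j}. ?D \<le> 2 * \<delta> (x r) (x j)}"
  define r where "r = Max H"
  have "i \<in> H"
    using less.prems nonneg[OF x x, of i j] by (simp add: H_def)
  moreover have "finite H"
    by (simp add: H_def)
  ultimately have rH: "r \<in> H" and rmax: "\<And>k. k \<in> H \<Longrightarrow> k \<le> r"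
    unfolding r_def by (auto intro: Max_in Max_ge)
  have right: "?D \<le> 2 * \<delta> (x r) (x j)" and r: "i \<le> r" "r < j"
    using rH by (auto simp: H_def)
  show ?case
  proof (cases "r = j - 1")
    case True
    then show ?thesis
      using right ends last e[of i] by simp
  next
    case False
    then have rj: "r + 2 \<le> j"
      using r by simp
    have "Suc r \<notin> H"
      using rmax[of "Suc r"] by auto
    then have "2 * \<delta> (x (Suc r)) (x j) < ?D"
      using rj r by (auto simp: H_def)
    then have left: "?D \<le> 2 * \<delta> (x i) (x (Suc r))"
      using tri[OF x x x, of i j "Suc r"] by linarith
    show ?thesis
    proof (cases "r = i")
      case True
      then show ?thesis
        using left ends last e[of "j - 1"] by simp
    next
      case False
      then have ir: "i + 2 \<le> Suc r"
        using r by simp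
      have "\<delta> (x i) (x (Suc r)) + 2 * ?e i + 2 * ?e r \<le> 4 * (\<Sum>k=i..<Suc r. ?e k)"
        using less.hyps[of "Suc r" i] ir rj by simp
      moreover have "\<delta> (x r) (x j) + 2 * ?e r + 2 * ?e (j - 1) \<le> 4 * (\<Sum>k=r..<j. ?e k)"
        using less.hyps[of j r] ir rj last by simp
      moreover have "(\<Sum>k=i..<Suc r. ?e k) + (\<Sum>k=r..<j. ?e k) = (\<Sum>k=i..<j. ?e k) + ?e r"
        using r sum.atLeastLessThan_concat[of i r j ?e] by simp
      ultimately show ?thesis
        using left right unfolding last by linarith
    qed
  qed
qed

text \<open>The function is the infimum of the chain sums from \<open>w\<close>. Appending a link to a chain gives the
  triangle-type bound, and the chain inequality keeps the infimum comparable to \<open>\<delta>(w,x)\<close>; without it the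
  infimum could vanish identically, as it does for the square of the Euclidean distance.\<close>

lemma exists_chain_gauge:
  fixes \<delta> :: "'a \<Rightarrow> 'a \<Rightarrow> real"
  assumes nonneg: "\<And>a b. a \<in> X \<Longrightarrow> b \<in> X \<Longrightarrow> 0 \<le> \<delta> a b"
    and tri: "\<And>a b c. a \<in> X \<Longrightarrow> b \<in> X \<Longrightarrow> c \<in> X \<Longrightarrow> \<delta> a b \<le> 2 * max (\<delta> a c) (\<delta> c b)"
    and w: "w \<in> X" "\<delta> w w = 0"
  shows "\<exists>f. (\<forall>x\<in>X. \<delta> w x \<le> 4 * f x) \<and> (\<forall>x\<in>X. \<forall>y\<in>X. f y \<le> f x + \<delta> x y)"
proof -
  define C where "C = (\<lambda>x. {(\<Sum>k=0..<n. \<delta> (c k) (c (Suc k))) | c n.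
    (\<forall>k. c k \<in> X) \<and> c 0 = w \<and> c n = x})"
  have ne: "C x \<noteq> {}" if "x \<in> X" for x
  proof -
    let ?c = "\<lambda>k::nat. if k = 0 then w else x"
    have "(\<Sum>k=0..<1. \<delta> (?c k) (?c (Suc k))) \<in> C x"
      unfolding C_def using w that by (intro CollectI exI[of _ ?c] exI[of _ "1::nat"]) simp
    then show ?thesis
      by blast
  qed
  have lower: "\<delta> w x \<le> 4 * s" if "s \<in> C x" for s x
  proof -
    obtain c n where s: "s = (\<Sum>k=0..<n. \<delta> (c k) (c (Suc k)))"
      and c: "\<And>k. c k \<in> X" "c 0 = w" "c n = x"
      using \<open>s \<in> C x\<close> by (auto simp: C_def)
    consider "n = 0" | "n = 1" | "2 \<le> n"
      by linarith
    then show ?thesis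
    proof cases
      case 1
      then show ?thesis
        using s c w by simp
    next
      case 2
      then show ?thesis
        using s c nonneg[OF c(1) c(1), of 0 1] by simp
    next
      case 3
      then have "\<delta> (c 0) (c n) + 2 * \<delta> (c 0) (c (Suc 0)) + 2 * \<delta> (c (n - 1)) (c n) \<le> 4 * s"
        unfolding s using chain_inequality[of X \<delta> c 0 n, OF nonneg tri c(1)] by simp
      then show ?thesis
        using c nonneg[OF c(1) c(1), of 0 "Suc 0"] nonneg[OF c(1) c(1), of "n - 1" n] by simp
    qed
  qed
  have bdd: "bdd_below (C x)" if "x \<in> X" for x
  proof (rule bdd_belowI)
    show "0 \<le> s" if "s \<in> C x" for s
      using lower[OF that] nonneg[OF w(1) \<open>x \<in> X\<close>] by linarith
  qed
  show ?thesis
  proof (intro exI[of _ "\<lambda>x. Inf (C x)"] conjI ballI)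
    fix x assume x: "x \<in> X"
    have "\<delta> w x / 4 \<le> Inf (C x)"
      using ne[OF x] lower by (intro cInf_greatest) (auto simp: field_simps)
    then show "\<delta> w x \<le> 4 * Inf (C x)"
      by simp
    fix y assume y: "y \<in> X"
    have "Inf (C y) - \<delta> x y \<le> s" if "s \<in> C x" for s
    proof -
      obtain c n where s: "s = (\<Sum>k=0..<n. \<delta> (c k) (c (Suc k)))"
        and c: "\<And>k. c k \<in> X" "c 0 = w" "c n = x"
        using \<open>s \<in> C x\<close> by (auto simp: C_def)
      let ?c = "\<lambda>k. if k \<le> n then c k else y"
      have "(\<Sum>k=0..<Suc n. \<delta> (?c k) (?c (Suc k))) \<in> C y"
        unfolding C_def using c y by (intro CollectI exI[of _ ?c] exI[of _ "Suc n"]) simp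
      moreover have "(\<Sum>k=0..<Suc n. \<delta> (?c k) (?c (Suc k))) = s + \<delta> x y"
        using c by (simp add: s)
      ultimately have "Inf (C y) \<le> s + \<delta> x y"
        using bdd[OF y] by (metis cInf_lower)
      then show ?thesis
        by simp
    qed
    then have "Inf (C y) - \<delta> x y \<le> Inf (C x)"
      using ne[OF x] by (intro cInf_greatest)
    then show "Inf (C y) \<le> Inf (C x) + \<delta> x y"
      by simp
  qed
qed

text \<open>The supremum defining the constant is over a set of reals bounded by any admissible \<open>C\<^sub>1\<close>, so it is an upper bound.\<close>

lemma le_qm_const:
  assumes q: "quasi_metric_on X \<rho>" and x: "x \<in> X" "y \<in> X" "z \<in> X"
  shows "\<rho> x y \<le> qm_const X \<rho> * max (\<rho> x z) (\<rho> z y)"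
proof (cases "x = y \<and> y = z")
  case True
  then show ?thesis
    using quasi_metric_on_eq_0_iff[OF q x(1) x(1)] by auto
next
  case False
  obtain C0 C1 where C: "0 < C0" "0 < C1"
    and sym: "\<And>x y. x \<in> X \<Longrightarrow> y \<in> X \<Longrightarrow> \<rho> y x \<le> C0 * \<rho> x y"
    and tri: "\<And>x y z. \<lbrakk>x \<in> X; y \<in> X; z \<in> X\<rbrakk> \<Longrightarrow> \<rho> x y \<le> C1 * max (\<rho> x z) (\<rho> z y)"
    by (fact quasi_metric_onE[OF q])
  have pos: "0 < max (\<rho> x z) (\<rho> z y)" if "x \<in> X" "y \<in> X" "z \<in> X" "\<not> (x = y \<and> y = z)" for x y z
    using that quasi_metric_on_nonneg[OF q] quasi_metric_on_eq_0_iff[OF q]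
    by (metis less_max_iff_disj order_le_less)
  let ?S = "{\<rho> x y / max (\<rho> x z) (\<rho> z y) | x y z.
     x \<in> X \<and> y \<in> X \<and> z \<in> X \<and> \<not> (x = y \<and> y = z)}"
  have "bdd_above ?S"
  proof (rule bdd_aboveI)
    fix t assume "t \<in> ?S"
    then obtain x y z where t: "t = \<rho> x y / max (\<rho> x z) (\<rho> z y)"
      and xyz: "x \<in> X" "y \<in> X" "z \<in> X" "\<not> (x = y \<and> y = z)"
      by blast
    show "t \<le> C1"
      using pos[OF xyz] tri[OF xyz(1-3)] by (simp only: t divide_le_eq if_True)
  qed
  then have "\<rho> x y / max (\<rho> x z) (\<rho> z y) \<le> qm_const X \<rho>"
    unfolding qm_const_def using x False by (intro cSup_upper) blast+
  then show ?thesis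
    using pos[OF x False] by (simp add: divide_le_eq)
qed

lemma qm_const_le_of_exponent:
  assumes "0 < \<beta>" "ennreal \<beta> \<le> qm_exponent X \<rho>"
  shows "qm_const X \<rho> \<le> 2 powr (1 / \<beta>)"
proof -
  let ?l = "log 2 (qm_const X \<rho>)"
  have "?l \<le> 1 / \<beta>"
  proof (cases "0 < ?l")
    case True
    then have "\<beta> \<le> 1 / ?l"
      using assms by (simp add: qm_exponent_def inverse_ennreal inverse_eq_divide)
    then show ?thesis
      using assms True by (simp add: field_simps)
  next
    case False
    then show ?thesis
      using assms by (smt (verit) divide_nonneg_pos)
  qed
  show ?thesis
  proof (cases "0 < qm_const X \<rho>")
    case True
    then show ?thesis
      using \<open>?l \<le> 1 / \<beta>\<close> by (simp add: log_le_iff)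
  next
    case False
    then show ?thesis
      by (smt (verit) powr_ge_zero)
  qed
qed

text \<open>Below the index there is room for an exponent \<open>\<beta>\<close> strictly larger than \<open>\<alpha>\<close>. At the index one has to
  take \<open>\<beta> = \<alpha>\<close>, which is possible because there the supremum is attained and \<open>q = \<infinity>\<close>.\<close>

lemma preceq_indexE:
  assumes "preceq_index \<alpha> q X d" "0 < \<alpha>"
  obtains \<rho> \<beta> where "\<rho> \<in> equivalent_qms X d" "\<alpha> \<le> \<beta>" "q = \<infinity> \<or> \<alpha> < \<beta>"
    "qm_const X \<rho> \<le> 2 powr (1 / \<beta>)"
proof (cases "ennreal \<alpha> = qm_index X d")
  case True
  then obtain \<rho> where "q = \<infinity>" "\<rho> \<in> equivalent_qms X d" "qm_exponent X \<rho> = ennreal \<alpha>"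
    using assms(1) unfolding preceq_index_def by auto
  then show ?thesis
    using that[of \<rho> \<alpha>] qm_const_le_of_exponent[OF assms(2), of X \<rho>] by simp
next
  case False
  then have "ennreal \<alpha> < qm_index X d"
    using assms(1) unfolding preceq_index_def by simp
  then obtain \<rho> where \<rho>: "\<rho> \<in> equivalent_qms X d" "ennreal \<alpha> < qm_exponent X \<rho>"
    unfolding qm_index_def less_SUP_iff by blast
  then obtain z where z: "ennreal \<alpha> < z" "z < qm_exponent X \<rho>"
    using dense by blast
  then obtain \<beta> where \<beta>: "z = ennreal \<beta>" "0 \<le> \<beta>"
    by (cases z) auto
  have "\<alpha> < \<beta>"
    using z \<beta> assms(2) by (simp add: ennreal_less_iff)
  then show ?thesis
    using that[of \<rho> \<beta>] \<rho>(1) z(2) \<beta>(1) qm_const_le_of_exponent[of \<beta> X \<rho>] assms(2) by simp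
qed

text \<open>The chain gauge of \<open>\<delta> = \<rho>\<^sup>\<beta>\<close>. The bound \<open>C\<^sub>\<rho> \<le> 2\<^bsup>1/\<beta>\<^esup>\<close> is exactly what makes the constant in the
  quasi-ultrametric inequality of \<open>\<delta>\<close> equal to \<open>2\<close>, as Frink's lemma requires.\<close>

lemma exists_Holder_gauge:
  assumes q: "quasi_metric_on X d" and pre: "preceq_index \<alpha> q X d" "0 < \<alpha>" and w: "w \<in> X"
  shows "\<exists>(f :: 'a \<Rightarrow> real) \<beta> L. \<alpha> \<le> \<beta> \<and> (q = \<infinity> \<or> \<alpha> < \<beta>) \<and> 0 < L \<and>
    (\<forall>x\<in>X. \<forall>y\<in>X. \<bar>f x - f y\<bar> \<le> L * d x y powr \<beta>) \<and>
    (\<forall>t. \<exists>r>0. {x \<in> X. f x < t} \<subseteq> qball X d w r)"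
proof -
  obtain \<rho> \<beta> where \<rho>: "\<rho> \<in> equivalent_qms X d" and \<beta>: "\<alpha> \<le> \<beta>" "q = \<infinity> \<or> \<alpha> < \<beta>"
    and const: "qm_const X \<rho> \<le> 2 powr (1 / \<beta>)"
    by (fact preceq_indexE[OF pre])
  have q\<rho>: "quasi_metric_on X \<rho>"
    using \<rho> by (simp add: equivalent_qms_def)
  obtain \<kappa> where \<kappa>: "0 < \<kappa>"
    and le\<rho>: "\<And>x y. x \<in> X \<Longrightarrow> y \<in> X \<Longrightarrow> \<rho> x y \<le> \<kappa> * d x y"
    and led: "\<And>x y. x \<in> X \<Longrightarrow> y \<in> X \<Longrightarrow> d x y \<le> \<kappa> * \<rho> x y"
  proof -
    obtain \<kappa> where k: "0 < \<kappa>" "\<forall>x\<in>X. \<forall>y\<in>X. inverse \<kappa> * \<rho> x y \<le> d x y \<and> d x y \<le> \<kappa> * \<rho> x y"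
      using \<rho> unfolding equivalent_qms_def equivalent_qm_def by blast
    show thesis
    proof (rule that[OF k(1)])
      show "\<rho> x y \<le> \<kappa> * d x y" if "x \<in> X" "y \<in> X" for x y
      proof -
        have "inverse \<kappa> * \<rho> x y \<le> d x y"
          using k that by blast
        then show ?thesis
          using k(1) by (simp add: field_simps)
      qed
      show "d x y \<le> \<kappa> * \<rho> x y" if "x \<in> X" "y \<in> X" for x y
        using k that by blast
    qed
  qed
  obtain C0 C1 where C: "0 < C0" "0 < C1"
    and sym: "\<And>x y. x \<in> X \<Longrightarrow> y \<in> X \<Longrightarrow> d y x \<le> C0 * d x y"
    and tri: "\<And>x y z. \<lbrakk>x \<in> X; y \<in> X; z \<in> X\<rbrakk> \<Longrightarrow> d x y \<le> C1 * max (d x z) (d z y)"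
    by (fact quasi_metric_onE[OF q])
  have bpos: "0 < \<beta>"
    using \<beta>(1) pre(2) by simp
  define \<delta> where "\<delta> = (\<lambda>x y. \<rho> x y powr \<beta>)"
  have tri2: "\<delta> x y \<le> 2 * max (\<delta> x z) (\<delta> z y)" if "x \<in> X" "y \<in> X" "z \<in> X" for x y z
  proof -
    have nn: "0 \<le> \<rho> x y" "0 \<le> \<rho> x z" "0 \<le> \<rho> z y"
      using that quasi_metric_on_nonneg[OF q\<rho>] by blast+
    have "\<rho> x y \<le> qm_const X \<rho> * max (\<rho> x z) (\<rho> z y)"
      by (rule le_qm_const[OF q\<rho> that])
    also have "\<dots> \<le> 2 powr (1 / \<beta>) * max (\<rho> x z) (\<rho> z y)"
      using nn by (intro mult_right_mono const) auto
    finally have "\<delta> x y \<le> (2 powr (1 / \<beta>) * max (\<rho> x z) (\<rho> z y)) powr \<beta>"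
      unfolding \<delta>_def using nn bpos by (intro powr_mono2) auto
    also have "\<dots> = 2 * max (\<rho> x z) (\<rho> z y) powr \<beta>"
      using bpos nn by (simp add: powr_mult powr_powr)
    also have "\<dots> \<le> 2 * max (\<delta> x z) (\<delta> z y)"
      unfolding \<delta>_def by (simp add: max_def)
    finally show ?thesis .
  qed
  have "\<delta> w w = 0"
    using quasi_metric_on_eq_0_iff[OF q\<rho> w w] by (simp add: \<delta>_def)
  then obtain f where f: "\<And>x. x \<in> X \<Longrightarrow> \<delta> w x \<le> 4 * f x"
      "\<And>x y. x \<in> X \<Longrightarrow> y \<in> X \<Longrightarrow> f y \<le> f x + \<delta> x y"
    using exists_chain_gauge[of X \<delta> w, OF _ tri2 w] by (force simp: \<delta>_def)
  define L where "L = (\<kappa> * (1 + C0)) powr \<beta>"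
  show ?thesis
  proof (rule exI[of _ f], rule exI[of _ \<beta>], rule exI[of _ L], intro conjI ballI allI \<beta>)
    show "0 < L"
      using \<kappa> C by (simp add: L_def)
    show "\<bar>f x - f y\<bar> \<le> L * d x y powr \<beta>" if x: "x \<in> X" and y: "y \<in> X" for x y
    proof -
      have nn: "0 \<le> d x y" "0 \<le> \<rho> x y" "0 \<le> \<rho> y x"
        using x y quasi_metric_on_nonneg[OF q] quasi_metric_on_nonneg[OF q\<rho>] by blast+
      have "\<rho> x y \<le> \<kappa> * (1 + C0) * d x y"
        using le\<rho>[OF x y] nn \<kappa> C by (simp add: distrib_left distrib_right add_increasing2)
      moreover have "\<rho> y x \<le> \<kappa> * (1 + C0) * d x y"
      proof -
        have "\<rho> y x \<le> \<kappa> * (C0 * d x y)"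
          using le\<rho>[OF y x] sym[OF x y] \<kappa> by (meson less_imp_le mult_left_mono order_trans)
        also have "\<dots> \<le> \<kappa> * (1 + C0) * d x y"
          using nn \<kappa> by (simp add: algebra_simps)
        finally show ?thesis .
      qed
      ultimately have "\<delta> x y \<le> (\<kappa> * (1 + C0) * d x y) powr \<beta>" "\<delta> y x \<le> (\<kappa> * (1 + C0) * d x y) powr \<beta>"
        unfolding \<delta>_def using nn bpos by (auto intro!: powr_mono2)
      moreover have "(\<kappa> * (1 + C0) * d x y) powr \<beta> = L * d x y powr \<beta>"
        using nn \<kappa> C by (simp add: L_def powr_mult)
      ultimately show ?thesis
        using f(2)[OF x y] f(2)[OF y x] by linarith
    qed
    show "\<exists>r>0. {x \<in> X. f x < t} \<subseteq> qball X d w r" for t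
    proof (intro exI conjI subsetI)
      let ?r = "\<kappa> * (4 * max t 0) powr (1 / \<beta>) + 1"
      show "0 < ?r"
        using \<kappa> by (simp add: add_nonneg_pos)
      fix x assume "x \<in> {x \<in> X. f x < t}"
      then have x: "x \<in> X" "f x < t"
        by auto
      have "\<rho> w x = (\<delta> w x) powr (1 / \<beta>)"
        using bpos quasi_metric_on_nonneg[OF q\<rho> w x(1)] by (simp add: \<delta>_def powr_powr)
      also have "\<dots> \<le> (4 * max t 0) powr (1 / \<beta>)"
        using f(1)[OF x(1)] x(2) bpos by (intro powr_mono2) (auto simp: \<delta>_def)
      finally have "d w x \<le> \<kappa> * (4 * max t 0) powr (1 / \<beta>)"
        using led[OF w x(1)] \<kappa> by (meson less_imp_le mult_left_mono order_trans)
      then show "x \<in> qball X d w ?r"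
        using x by (simp add: qball_def)
    qed
  qed
qed

text \<open>Hoelder continuity makes the strict sublevel sets open, and open sets are measurable by hypothesis, although balls need not be open.\<close>

lemma borel_measurable_of_Holder:
  fixes f :: "'a \<Rightarrow> real"
  assumes qm: "quasi_metric_measure_space M d" and "0 < \<beta>" "0 < L"
    and f: "\<And>x y. x \<in> space M \<Longrightarrow> y \<in> space M \<Longrightarrow> \<bar>f x - f y\<bar> \<le> L * d x y powr \<beta>"
  shows "f \<in> borel_measurable M"
  unfolding borel_measurable_iff_less
proof
  fix a
  have q: "quasi_metric_on (space M) d"
    using qm by (simp add: quasi_metric_measure_space_def)
  have "\<exists>r>0. qball (space M) d x r \<subseteq> {w \<in> space M. f w < a}" if x: "x \<in> space M" "f x < a" for x
  proof (intro exI conjI subsetI)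
    let ?r = "((a - f x) / L) powr (1 / \<beta>)"
    show "0 < ?r"
      using x assms by simp
    fix y assume "y \<in> qball (space M) d x ?r"
    then have y: "y \<in> space M" "d x y < ?r"
      by (auto simp: qball_def)
    have "d x y powr \<beta> < ?r powr \<beta>"
      using y quasi_metric_on_nonneg[OF q x(1) y(1)] assms by (intro powr_less_mono2) auto
    also have "\<dots> = (a - f x) / L"
      using x assms by (simp add: powr_powr)
    finally have "L * d x y powr \<beta> < a - f x"
      using assms by (simp add: field_simps)
    then show "y \<in> {w \<in> space M. f w < a}"
      using f[OF x(1) y(1)] y by auto
  qed
  then have "{w \<in> space M. f w < a} \<in> qtopology (space M) d"
    by (auto simp: qtopology_def)
  then show "{w \<in> space M. f w < a} \<in> sets M"
    using qm unfolding quasi_metric_measure_space_def by (auto intro: sigma_sets.Basic)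
qed

section \<open>Bump functions at unit scale\<close>

text \<open>The profile of the gradient of a bump function over the dyadic scales. At fine scales (\<open>k \<ge> 0\<close>) the decay
  comes from \<open>b = \<beta> - \<alpha>\<close>, which may vanish only for \<open>q = \<infinity>\<close>; at coarse scales it comes from \<open>a = \<alpha>\<close>.\<close>

lemma lq_norm_two_sided_geometric:
  fixes a b :: real
  assumes q: "0 < q" and a: "0 < a" and b: "0 \<le> b" "q = \<infinity> \<or> 0 < b"
  shows "lq_norm q (\<lambda>k. ennreal (if 0 \<le> k then 2 powr (- (b * of_int k)) else 2 powr (a * of_int (k + 1))))
    < \<infinity>" (is "lq_norm q (\<lambda>k. ennreal (?c k)) < _")
proof (cases "q = \<infinity>")
  case True
  have le_1: "2 powr x \<le> 1" if "x \<le> 0" for x :: real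
    using powr_mono[OF that, of 2] by simp
  have "?c k \<le> 1" for k :: int
  proof (cases "0 \<le> k")
    case True
    then show ?thesis
      using b by (simp add: le_1)
  next
    case False
    then have "of_int (k + 1) \<le> (0::real)"
      by linarith
    then have "a * of_int (k + 1) \<le> 0"
      using a by (intro mult_nonneg_nonpos) auto
    then show ?thesis
      using False by (simp only: le_1 if_False)
  qed
  then have "(SUP k. ennreal (?c k)) \<le> 1"
    by (intro SUP_least) simp
  then show ?thesis
    using True by (auto simp: lq_norm_def intro: le_less_trans)
next
  case False
  define t where "t = enn2real q"
  have t: "0 < t"
    using q False by (simp add: t_def enn2real_positive_iff less_top)
  have b: "0 < b"
    using b False by blast
  let ?F = "\<lambda>k::int. ennreal (?c k powr t)"
  have geo: "(\<Sum>n. ennreal (C * y ^ n)) < \<infinity>" if "0 \<le> C" "0 \<le> y" "y < 1" for C y :: real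
    using that sums_mult[OF geometric_sums[of y], of C] by (subst suminf_ennreal_eq) auto
  let ?y = "2 powr (- (b * t))" and ?z = "2 powr (- (a * t))"
  have y: "?y < 1" "?z < 1"
    using a b t by (auto simp: powr_less_one)
  have F1: "?F (int n) = ennreal (1 * ?y ^ n)" for n
    by (simp add: powr_powr mult_ac flip: powr_realpow)
  have F2: "?F (- int n - 1) = ennreal (1 * ?z ^ n)" for n
    by (simp add: powr_powr mult_ac flip: powr_realpow)
  have "(\<integral>\<^sup>+ k. ?F k \<partial>count_space UNIV)
    \<le> (\<integral>\<^sup>+ k. ?F k * indicator (range int) k + ?F k * indicator (range (\<lambda>n. - int n - 1)) k \<partial>count_space UNIV)"
  proof (rule nn_integral_mono)
    fix k :: int
    have "k \<in> range int \<or> k \<in> range (\<lambda>n. - int n - 1)"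
    proof (cases "0 \<le> k")
      case True
      then show ?thesis
        by (auto simp: image_iff dest: zero_le_imp_eq_int)
    next
      case False
      then have "k = - int (nat (- k - 1)) - 1"
        by simp
      then show ?thesis
        by blast
    qed
    then show "?F k \<le> ?F k * indicator (range int) k + ?F k * indicator (range (\<lambda>n. - int n - 1)) k"
      by (auto simp: indicator_def)
  qed
  also have "\<dots> = (\<integral>\<^sup>+ k. ?F k \<partial>count_space (range int))
      + (\<integral>\<^sup>+ k. ?F k \<partial>count_space (range (\<lambda>n. - int n - 1)))"
    by (subst nn_integral_add) (simp_all add: nn_integral_count_space_indicator)
  also have "(\<integral>\<^sup>+ k. ?F k \<partial>count_space (range int)) = (\<integral>\<^sup>+ n. ?F (int n) \<partial>count_space UNIV)"
    by (rule nn_integral_bij_count_space[symmetric]) (auto simp: bij_betw_def inj_on_def)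
  also have "(\<integral>\<^sup>+ k. ?F k \<partial>count_space (range (\<lambda>n. - int n - 1)))
      = (\<integral>\<^sup>+ n. ?F (- int n - 1) \<partial>count_space UNIV)"
    by (rule nn_integral_bij_count_space[symmetric]) (auto simp: bij_betw_def inj_on_def)
  also have "(\<integral>\<^sup>+ n. ?F (int n) \<partial>count_space UNIV) + (\<integral>\<^sup>+ n. ?F (- int n - 1) \<partial>count_space UNIV) < \<infinity>"
  proof -
    have "(\<Sum>n. ennreal (1 * ?y ^ n)) < \<infinity>" "(\<Sum>n. ennreal (1 * ?z ^ n)) < \<infinity>"
      by (intro geo y; simp)+
    then show ?thesis
      unfolding F1 F2 nn_integral_count_space_nat
      by (simp only: infinity_ennreal_def less_top[symmetric] ennreal_add_eq_top) simp
  qed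
  finally have "(\<integral>\<^sup>+ k. ?F k \<partial>count_space UNIV) < \<infinity>" .
  moreover have "lq_norm q (\<lambda>k. ennreal (?c k)) = ennpowr (\<integral>\<^sup>+ k. ?F k \<partial>count_space UNIV) (1 / t)"
    using False by (simp add: lq_norm_def enn_Lp_norm_def ennpowr_ennreal flip: t_def)
  ultimately show ?thesis
    by (simp add: ennpowr_def)
qed

text \<open>The gradient is a constant \<open>(L'/h) c\<^sub>k\<close> times the indicator of \<open>{f < r + h}\<close>. At fine scales it comes from the
  Hoelder bound \<open>|u(x) - u(y)| \<le> (L/h) d(x,y)\<^sup>\<beta>\<close> with \<open>d(x,y)\<^bsup>\<beta>-\<alpha>\<^esup> \<le> 2\<^bsup>-k(\<beta>-\<alpha>)\<^esup>\<close>, at coarse scales from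
  \<open>|u(x) - u(y)| \<le> 1\<close> alone. As the gradient is a product of a function of \<open>k\<close> and a function of \<open>x\<close>, its two mixed
  norms agree. The restriction \<open>h \<le> 1\<close> allows one factor \<open>1/h\<close> to absorb both the bound at coarse scales
  and \<open>\<parallel>u\<parallel>\<^sub>p\<close>.\<close>

lemma bump_norm_estimate:
  fixes M :: "'a measure" and f :: "'a \<Rightarrow> real"
  assumes q: "0 < q" and p: "0 < p" and \<alpha>: "0 < \<alpha>" "\<alpha> \<le> \<beta>" "q = \<infinity> \<or> \<alpha> < \<beta>" and L: "0 < L"
    and d: "\<And>x y. x \<in> space M \<Longrightarrow> y \<in> space M \<Longrightarrow> 0 \<le> d x y"
    and f [measurable]: "f \<in> borel_measurable M"
    and Holder: "\<And>x y. x \<in> space M \<Longrightarrow> y \<in> space M \<Longrightarrow> \<bar>f x - f y\<bar> \<le> L * d x y powr \<beta>"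
  shows "\<exists>K>0. \<forall>r h. 0 < h \<longrightarrow> h \<le> 1 \<longrightarrow>
    (let u = (\<lambda>x. max 0 (min 1 ((r + h - f x) / h)));
         N = ennreal (K / h) * ennpowr (emeasure M {x \<in> space M. f x < r + h}) (1 / p)
     in TL_norm M d \<alpha> p q u \<le> N \<and> Besov_norm M d \<alpha> p q u \<le> N \<and>
        Lp_norm M p u \<le> ennpowr (emeasure M {x \<in> space M. f x < r + h}) (1 / p))"
proof -
  define c where "c = (\<lambda>k::int. if 0 \<le> k then 2 powr (- ((\<beta> - \<alpha>) * of_int k))
    else 2 powr (\<alpha> * of_int (k + 1)))"
  have "lq_norm q (\<lambda>k. ennreal (c k)) < \<infinity>"
    unfolding c_def using assms by (intro lq_norm_two_sided_geometric) auto
  then obtain Q where Q: "lq_norm q (\<lambda>k. ennreal (c k)) = ennreal Q" "0 \<le> Q"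
    by (cases "lq_norm q (\<lambda>k. ennreal (c k))") auto
  have c: "0 \<le> c k" for k
    by (simp add: c_def)
  define L' where "L' = max 1 L"
  define K where "K = 1 + L' * Q"
  have K: "0 < K" "1 \<le> K"
    using Q by (auto simp: K_def L'_def intro!: add_pos_nonneg)
  show ?thesis
  proof (intro exI[of _ K] conjI K allI impI)
    fix r h :: real assume h: "0 < h" "h \<le> 1"
    define u where "u = (\<lambda>x. max 0 (min 1 ((r + h - f x) / h)))"
    define A where "A = {x \<in> space M. f x < r + h}"
    let ?m = "ennpowr (emeasure M A) (1 / p)"
    have [measurable]: "A \<in> sets M" "u \<in> borel_measurable M"
      unfolding A_def u_def by measurable
    have u01: "0 \<le> u x" "u x \<le> 1" for x
      by (auto simp: u_def)
    have uA: "u x = 0" if "x \<in> space M" "x \<notin> A" for x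
      using that h by (auto simp: u_def A_def field_simps)
    define g where "g = (\<lambda>(k::int) x. L' / h * c k * indicator A x)"
    have L'h: "1 \<le> L' / h" "L / h \<le> L' / h"
      using h by (auto simp: L'_def le_divide_eq divide_right_mono)
    have g: "g \<in> fractional_gradients M d \<alpha> u"
      unfolding fractional_gradients_def
    proof (intro CollectI conjI allI ballI bexI[of _ "{}"] impI)
      show "g k \<in> borel_measurable M" for k
        unfolding g_def by measurable
      show "0 \<le> g k x" for k x
        using c L'h unfolding g_def by (intro mult_nonneg_nonneg) auto
      fix k x y
      assume xy: "x \<in> space M - {}" "y \<in> space M - {}"
        and k: "2 powi (- k - 1) \<le> d x y \<and> d x y < 2 powi (- k)"
      have dpos: "0 < d x y"
        using k by (meson less_le_trans zero_less_numeral zero_less_power_int)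
      have step: "\<bar>u x - u y\<bar> \<le> d x y powr \<alpha> * (L' / h * c k)"
      proof (cases "0 \<le> k")
        case True
        have "\<bar>u x - u y\<bar> \<le> \<bar>(r + h - f x) / h - (r + h - f y) / h\<bar>"
          unfolding u_def by (auto simp: max_def min_def)
        also have "\<dots> = \<bar>f x - f y\<bar> / h"
          using h by (simp add: abs_minus_commute flip: diff_divide_distrib)
        also have "\<dots> \<le> L * d x y powr \<beta> / h"
          using Holder xy h by (intro divide_right_mono) auto
        also have "\<dots> = L / h * (d x y powr \<alpha> * d x y powr (\<beta> - \<alpha>))"
          by (simp flip: powr_add)
        also have "\<dots> \<le> L' / h * (d x y powr \<alpha> * c k)"
        proof (intro mult_mono L'h order_refl)
          have "d x y powr (\<beta> - \<alpha>) \<le> (2 powr of_int (- k)) powr (\<beta> - \<alpha>)"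
            using k \<alpha> dpos powr_real_of_int'[of 2 "- k"] by (intro powr_mono2) auto
          also have "\<dots> = c k"
            using True by (simp add: c_def powr_powr mult_ac)
          finally show "d x y powr (\<beta> - \<alpha>) \<le> c k" .
        qed (use L'h in auto)
        finally show ?thesis
          by (simp add: mult_ac)
      next
        case False
        have "\<bar>u x - u y\<bar> \<le> 1"
          using u01[of x] u01[of y] by linarith
        also have "1 = (2 powr of_int (- k - 1)) powr \<alpha> * c k"
          using False by (simp add: c_def powr_powr algebra_simps flip: powr_add)
        also have "\<dots> \<le> d x y powr \<alpha> * (1 * c k)"
        proof -
          have "2 powr of_int (- k - 1) \<le> d x y"
            using k powr_real_of_int'[of 2 "- k - 1"] by simp
          then show ?thesis
            using \<alpha> c[of k] by (simp add: mult_right_mono powr_mono2)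
        qed
        also have "\<dots> \<le> d x y powr \<alpha> * (L' / h * c k)"
          using L'h c by (intro mult_left_mono mult_right_mono) auto
        finally show ?thesis .
      qed
      show "\<bar>u x - u y\<bar> \<le> d x y powr \<alpha> * (g k x + g k y)"
      proof (cases "x \<in> A \<or> y \<in> A")
        case True
        then have "L' / h * c k * 1 \<le> L' / h * c k * (indicator A x + indicator A y)"
          using c L'h by (intro mult_left_mono mult_nonneg_nonneg) (auto simp: indicator_def)
        then have "L' / h * c k \<le> g k x + g k y"
          by (simp add: g_def distrib_left)
        then show ?thesis
          using step by (meson mult_left_mono order_trans powr_ge_zero)
      next
        case False
        then show ?thesis
          using uA xy by (simp add: g_def)
      qed
    qed simp
    have gk: "ennreal (g k x) = (ennreal (L' / h) * indicator A x) * ennreal (c k)" for k x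
      using c L'h by (auto simp: g_def indicator_def simp flip: ennreal_mult)
    have ind: "enn_Lp_norm M p (\<lambda>x. C * indicator A x) = C * ?m" for C
      using p by (simp add: enn_Lp_norm_cmult enn_Lp_norm_indicator)
    have TL: "enn_Lp_norm M p (\<lambda>x. lq_norm q (\<lambda>k. ennreal (g k x))) = ennreal (L' / h) * ennreal Q * ?m"
    proof -
      have "(\<lambda>x. lq_norm q (\<lambda>k. ennreal (g k x))) = (\<lambda>x. (ennreal (L' / h) * ennreal Q) * indicator A x)"
        unfolding gk lq_norm_cmult[OF q] Q(1) by (simp add: mult_ac)
      then show ?thesis
        unfolding ind[symmetric] by (rule arg_cong)
    qed
    have B: "lq_norm q (\<lambda>k. Lp_norm M p (g k)) = ennreal (L' / h) * ennreal Q * ?m"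
    proof -
      have LB: "Lp_norm M p (g k) = (ennreal (L' / h) * ?m) * ennreal (c k)" for k
      proof -
        have "\<bar>g k x\<bar> = g k x" for x
          using c L'h unfolding g_def by (intro abs_of_nonneg mult_nonneg_nonneg) auto
        then have "Lp_norm M p (g k) = enn_Lp_norm M p (\<lambda>x. (ennreal (L' / h) * ennreal (c k)) * indicator A x)"
          unfolding Lp_norm_def by (simp add: gk mult_ac)
        then show ?thesis
          unfolding ind by (simp add: mult_ac)
      qed
      show ?thesis
        unfolding LB lq_norm_cmult[OF q] Q(1) by (simp add: mult_ac)
    qed
    have Lp: "Lp_norm M p u \<le> ?m"
    proof -
      have "Lp_norm M p u \<le> enn_Lp_norm M p (indicator A)"
        unfolding Lp_norm_def using u01 uA
        by (intro enn_Lp_norm_mono p) (auto simp: indicator_def)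
      then show ?thesis
        using p by (simp add: enn_Lp_norm_indicator)
    qed
    have sum: "?m + ennreal (L' / h) * ennreal Q * ?m \<le> ennreal (K / h) * ?m"
    proof -
      have "1 + L' / h * Q \<le> K / h"
        using h Q by (simp add: K_def add_divide_distrib)
      then have "ennreal (1 + L' / h * Q) * ?m \<le> ennreal (K / h) * ?m"
        by (intro mult_right_mono ennreal_leI) auto
      moreover have "ennreal (1 + L' / h * Q) = 1 + ennreal (L' / h) * ennreal Q"
      proof -
        have LQ: "0 \<le> L' / h * Q"
          using L'h Q by (intro mult_nonneg_nonneg) auto
        have "ennreal (1 + L' / h * Q) = ennreal 1 + ennreal (L' / h * Q)"
          by (rule ennreal_plus[OF zero_le_one LQ])
        also have "ennreal (L' / h * Q) = ennreal (L' / h) * ennreal Q"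
          by (rule ennreal_mult) (use L'h Q in auto)
        finally show ?thesis
          by (simp only: ennreal_1)
      qed
      ultimately show ?thesis
        by (simp add: distrib_right)
    qed
    have "TL_norm M d \<alpha> p q u \<le> ?m + ennreal (L' / h) * ennreal Q * ?m"
      unfolding TL_norm_def TL[symmetric] by (intro add_mono Lp INF_lower g)
    moreover have "Besov_norm M d \<alpha> p q u \<le> ?m + ennreal (L' / h) * ennreal Q * ?m"
      unfolding Besov_norm_def B[symmetric] by (intro add_mono Lp INF_lower g)
    ultimately show "let u = (\<lambda>x. max 0 (min 1 ((r + h - f x) / h)));
         N = ennreal (K / h) * ennpowr (emeasure M {x \<in> space M. f x < r + h}) (1 / p)
       in TL_norm M d \<alpha> p q u \<le> N \<and> Besov_norm M d \<alpha> p q u \<le> N \<and>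
        Lp_norm M p u \<le> ennpowr (emeasure M {x \<in> space M. f x < r + h}) (1 / p)"
      using sum Lp unfolding Let_def u_def[symmetric] A_def[symmetric] by (auto intro: order_trans)
  qed
qed

section \<open>Iterating the growth inequality\<close>

text \<open>Put \<open>R\<^sub>j = r + 1 - 2\<^bsup>-j\<^esup>\<close> and \<open>s\<^sub>j = ln m(R\<^sub>j)\<close>. The hypothesis becomes \<open>\<theta> s\<^sub>j \<le> s\<^bsub>j+1\<^esub> + B(j+1)\<close> with
  \<open>\<theta> = p/p' > 1\<close>. Subtracting the affine function \<open>a j + a'\<close>, with \<open>a\<close> and \<open>a'\<close> solving
  \<open>(\<theta> - 1)(a j + a') = B(j+1) + a\<close>, removes the error term and leaves \<open>t\<^bsub>j+1\<^esub> \<ge> \<theta> t\<^sub>j\<close>. If \<open>m(r) > exp a'\<close>, then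
  \<open>t\<^sub>0 > 0\<close>, so \<open>t\<^sub>j\<close> grows geometrically, although \<open>t\<^sub>j \<le> ln m(r+1)\<close> for all \<open>j\<close>.\<close>

lemma bounded_of_self_improving_growth:
  fixes m :: "real \<Rightarrow> real"
  assumes p: "0 < p'" "p' < p" and K: "0 < K" and mono: "mono m"
    and growth: "\<And>r h. 0 < h \<Longrightarrow> h \<le> 1 \<Longrightarrow> m r powr (1 / p') \<le> K / h * m (r + h) powr (1 / p)"
  shows "\<exists>C. \<forall>r. m r \<le> C"
proof -
  define \<theta> where "\<theta> = p / p'"
  define B where "B = p * (\<bar>ln K\<bar> + ln 2)"
  define a where "a = B / (\<theta> - 1)"
  define a' where "a' = (B + a) / (\<theta> - 1)"
  have \<theta>: "1 < \<theta>"
    using p by (simp add: \<theta>_def)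
  have B: "0 \<le> B" "0 \<le> a" "0 \<le> a'"
    using p \<theta> by (auto simp: B_def a_def a'_def)
  have "m r \<le> exp a'" for r
  proof (rule ccontr)
    assume "\<not> m r \<le> exp a'"
    then have mr: "exp a' < m r"
      by simp
    define R where "R = (\<lambda>j::nat. r + 1 - 1 / 2 ^ j)"
    have R: "r \<le> R j" "R j \<le> r + 1" "R (Suc j) = R j + 1 / 2 ^ Suc j" for j
      by (auto simp: R_def)
    have mpos: "0 < m s" if "r \<le> s" for s
      using mr monoD[OF mono that] by (meson exp_gt_zero less_le_trans order_less_trans)
    define s where "s = (\<lambda>j. ln (m (R j)))"
    have rec: "\<theta> * s j \<le> s (Suc j) + B * (real j + 1)" for j
    proof -
      have h: "(0::real) < 1 / 2 ^ Suc j" "1 / 2 ^ Suc j \<le> (1::real)"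
        by (simp_all add: divide_le_eq one_le_power del: power_Suc)
      have pos: "0 < m (R j)" "0 < m (R (Suc j))"
        using mpos[OF R(1)[of j]] mpos[OF R(1)[of "Suc j"]] by auto
      have "ln (m (R j) powr (1 / p')) \<le> ln (K * 2 ^ Suc j * m (R (Suc j)) powr (1 / p))"
        using growth[OF h, of "R j"] pos K unfolding R(3) by (subst ln_le_cancel_iff) auto
      also have "\<dots> = ln K + real (Suc j) * ln 2 + 1 / p * s (Suc j)"
        using pos K by (simp add: ln_mult_pos ln_realpow ln_powr s_def del: power_Suc)
      finally have "1 / p' * s j \<le> ln K + real (Suc j) * ln 2 + 1 / p * s (Suc j)"
        using pos by (simp add: ln_powr s_def)
      then have "p * (1 / p' * s j) \<le> p * (ln K + real (Suc j) * ln 2 + 1 / p * s (Suc j))"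
        using p by (intro mult_left_mono) auto
      also have "\<dots> = p * (ln K + real (Suc j) * ln 2) + s (Suc j)"
        using p by (simp add: distrib_left)
      also have "p * (ln K + real (Suc j) * ln 2) \<le> p * ((\<bar>ln K\<bar> + ln 2) * (real j + 1))"
      proof (intro mult_left_mono)
        have "ln K \<le> \<bar>ln K\<bar> * (real j + 1)"
        proof -
          have "ln K \<le> \<bar>ln K\<bar> * 1"
            by simp
          also have "\<dots> \<le> \<bar>ln K\<bar> * (real j + 1)"
            by (intro mult_left_mono) auto
          finally show ?thesis .
        qed
        then show "ln K + real (Suc j) * ln 2 \<le> (\<bar>ln K\<bar> + ln 2) * (real j + 1)"
          by (simp add: algebra_simps)
      qed (use p in auto)
      finally show ?thesis
        by (simp add: \<theta>_def B_def mult_ac)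
    qed
    define t where "t = (\<lambda>j. s j - a * real j - a')"
    have t_rec: "\<theta> * t j \<le> t (Suc j)" for j
    proof -
      have "(\<theta> - 1) * (a * real j + a') = B * real j + B + a"
      proof -
        have "a * (\<theta> - 1) = B" "a' * (\<theta> - 1) = B + a"
          using \<theta> by (simp_all add: a_def a'_def)
        moreover have "(\<theta> - 1) * (a * real j + a') = a * (\<theta> - 1) * real j + a' * (\<theta> - 1)"
          by (simp add: algebra_simps)
        ultimately show ?thesis
          by simp
      qed
      then have "\<theta> * (a * real j + a') = a * real j + a' + (B * (real j + 1) + a)"
        by (simp add: algebra_simps)
      moreover have "\<theta> * t j = \<theta> * s j - \<theta> * (a * real j + a')"
        by (simp add: t_def algebra_simps)
      moreover have "t (Suc j) = s (Suc j) - a * real j - a' - a"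
        by (simp add: t_def algebra_simps)
      ultimately show ?thesis
        using rec[of j] by linarith
    qed
    have t_ge: "\<theta> ^ j * t 0 \<le> t j" for j
    proof (induction j)
      case (Suc j)
      have "\<theta> ^ Suc j * t 0 \<le> \<theta> * t j"
        using Suc \<theta> by (simp add: mult.assoc)
      then show ?case
        using t_rec[of j] by linarith
    qed simp
    have t0: "0 < t 0"
    proof -
      have "ln (exp a') < ln (m r)"
        using mr mpos[of r] by (subst ln_less_cancel_iff) auto
      then show ?thesis
        by (simp add: t_def s_def R_def)
    qed
    obtain j where j: "ln (m (r + 1)) / t 0 < \<theta> ^ j"
      using real_arch_pow[OF \<theta>] by blast
    have "0 \<le> a * real j"
      using B by simp
    then have "t j \<le> s j"
      unfolding t_def using B(3) by linarith
    also have "\<dots> \<le> ln (m (r + 1))"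
      unfolding s_def using mpos R monoD[OF mono R(2)[of j]] by (subst ln_le_cancel_iff) auto
    also have "\<dots> < \<theta> ^ j * t 0"
      using j t0 by (simp add: divide_less_eq)
    finally show False
      using t_ge[of j] by simp
  qed
  then show ?thesis
    by blast
qed

text \<open>The embedding inequality for the bump at height \<open>r\<close> and width \<open>h\<close> is the growth inequality for
  \<open>m(r) = \<mu>{f < r}\<close>; the sublevel sets exhaust the space, so a bound on \<open>m\<close> bounds the total mass.\<close>

lemma finite_measure_of_continuous_embedding:
  fixes M :: "'a measure"
  assumes qm: "quasi_metric_measure_space M d" and pre: "preceq_index \<alpha> q (space M) d"
    and pos: "0 < \<alpha>" "0 < q" "0 < p'" "p' < p"
    and A: "\<And>u. u \<in> Lp_space M p \<Longrightarrow> nA u < \<infinity> \<Longrightarrow> u \<in> A"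
    and nA: "nA = TL_norm M d \<alpha> p q \<or> nA = Besov_norm M d \<alpha> p q"
    and emb: "continuous_embedding A nA (Lp_space M p') (Lp_norm M p')"
  shows "emeasure M (space M) < \<infinity>"
proof -
  have q: "quasi_metric_on (space M) d"
    using qm by (simp add: quasi_metric_measure_space_def)
  have p: "0 < p"
    using pos by simp
  obtain w where w: "w \<in> space M"
    using q unfolding quasi_metric_on_def by blast
  obtain f \<beta> L where \<beta>: "\<alpha> \<le> \<beta>" "q = \<infinity> \<or> \<alpha> < \<beta>" and L: "0 < L"
    and Holder': "\<forall>x\<in>space M. \<forall>y\<in>space M. \<bar>f x - f y\<bar> \<le> L * d x y powr \<beta>"
    and sub: "\<forall>t. \<exists>r>0. {x \<in> space M. f x < t} \<subseteq> qball (space M) d w r"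
    using exists_Holder_gauge[OF q pre pos(1) w] by (elim exE conjE)
  have Holder: "\<bar>f x - f y\<bar> \<le> L * d x y powr \<beta>" if "x \<in> space M" "y \<in> space M" for x y
    using Holder' that by blast
  have f [measurable]: "f \<in> borel_measurable M"
    using borel_measurable_of_Holder[OF qm _ L Holder] pos \<beta> by simp
  let ?A = "\<lambda>t. {x \<in> space M. f x < t}"
  have finA: "emeasure M (?A t) < \<infinity>" for t
  proof -
    obtain r where r: "0 < r" "?A t \<subseteq> qball (space M) d w r"
      using sub by blast
    have "qball (space M) d w r \<in> sets M" "emeasure M (qball (space M) d w r) < \<infinity>"
      using qm w r(1) unfolding quasi_metric_measure_space_def by blast+
    then show ?thesis
      using emeasure_mono[OF r(2)] by (meson le_less_trans)
  qed
  define m where "m = (\<lambda>t. measure M (?A t))"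
  have m: "emeasure M (?A t) = ennreal (m t)" "0 \<le> m t" for t
    unfolding m_def using finA[of t] by (auto intro: emeasure_eq_ennreal_measure)
  have mono_m: "mono m"
    unfolding m_def using finA by (intro monoI measure_mono_fmeasurable) (auto simp: fmeasurable_def)
  obtain C where C: "0 \<le> C" and emb_le: "\<And>u. u \<in> A \<Longrightarrow> Lp_norm M p' u \<le> ennreal C * nA u"
    using emb unfolding continuous_embedding_def by blast
  obtain K where K: "0 < K" and bump: "\<And>r h. 0 < h \<Longrightarrow> h \<le> 1 \<Longrightarrow>
      (let u = (\<lambda>x. max 0 (min 1 ((r + h - f x) / h)));
         N = ennreal (K / h) * ennpowr (emeasure M (?A (r + h))) (1 / p)
       in TL_norm M d \<alpha> p q u \<le> N \<and> Besov_norm M d \<alpha> p q u \<le> N \<and>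
        Lp_norm M p u \<le> ennpowr (emeasure M (?A (r + h))) (1 / p))"
    using bump_norm_estimate[OF pos(2) p pos(1) \<beta> L quasi_metric_on_nonneg[OF q] f Holder] by blast
  have "m r powr (1 / p') \<le> (C + 1) * K / h * m (r + h) powr (1 / p)" if h: "0 < h" "h \<le> 1" for r h
  proof -
    define u where "u = (\<lambda>x. max 0 (min 1 ((r + h - f x) / h)))"
    have [measurable]: "u \<in> borel_measurable M"
      unfolding u_def by measurable
    have N: "nA u \<le> ennreal (K / h) * ennreal (m (r + h) powr (1 / p))"
      and Lp: "Lp_norm M p u \<le> ennreal (m (r + h) powr (1 / p))"
      using bump[OF h, of r] nA unfolding Let_def u_def[symmetric]
      by (auto simp: m ennpowr_ennreal)
    have "u \<in> A"
    proof (rule A)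
      show "u \<in> Lp_space M p"
        using Lp by (auto simp: Lp_space_def intro: le_less_trans)
      show "nA u < \<infinity>"
        using N by (rule le_less_trans) (simp add: ennreal_mult_less_top)
    qed
    have "ennreal (m r powr (1 / p')) = enn_Lp_norm M p' (indicator (?A r))"
      using pos by (simp add: enn_Lp_norm_indicator m ennpowr_ennreal)
    also have "\<dots> \<le> Lp_norm M p' u"
      unfolding Lp_norm_def using h
      by (intro enn_Lp_norm_mono pos) (auto simp: indicator_def u_def min_def field_simps)
    also have "\<dots> \<le> ennreal C * nA u"
      by (rule emb_le) fact
    also have "\<dots> \<le> ennreal (C + 1) * (ennreal (K / h) * ennreal (m (r + h) powr (1 / p)))"
      using C N by (intro mult_mono ennreal_leI) auto
    also have "\<dots> = ennreal ((C + 1) * (K / h * m (r + h) powr (1 / p)))"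
      using C K h by (subst ennreal_mult, simp, simp, subst ennreal_mult) auto
    also have "(C + 1) * (K / h * m (r + h) powr (1 / p)) = (C + 1) * K / h * m (r + h) powr (1 / p)"
      by simp
    finally show ?thesis
      using C K h by (subst (asm) ennreal_le_iff) auto
  qed
  \<comment> \<open>\<open>C + 1\<close> instead of \<open>C\<close> makes the growth constant positive.\<close>
  then obtain B where B: "\<And>r. m r \<le> B"
    using bounded_of_self_improving_growth[OF pos(3,4) _ mono_m, of "(C + 1) * K"] C K by auto
  have "emeasure M (space M) = emeasure M (\<Union>n::nat. ?A (real n))"
    by (rule arg_cong[of _ _ "emeasure M"]) (auto intro: reals_Archimedean2)
  also have "\<dots> = (SUP n::nat. emeasure M (?A (real n)))"
    by (intro SUP_emeasure_incseq[symmetric]) (auto simp: incseq_def)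
  also have "\<dots> \<le> ennreal B"
    unfolding m using B by (intro SUP_least ennreal_leI)
  finally show ?thesis
    by (rule le_less_trans) simp
qed

theorem theorem6p15:
  fixes M :: "'a measure" and d :: "'a \<Rightarrow> 'a \<Rightarrow> real"
  assumes "quasi_metric_measure_space M d"
  shows "(emeasure M (space M) < \<infinity> \<longrightarrow>
           (\<forall>(\<alpha>::real) (p::real) (q::ennreal) (p'::real).
              0 < \<alpha> \<and> 0 < p \<and> 0 < q \<and> 0 < p' \<and> p' < p \<longrightarrow>
              compact_embedding (TL_space M d \<alpha> p q) (TL_norm M d \<alpha> p q)
                (Lp_space M p') (Lp_norm M p') \<and>
              compact_embedding (Besov_space M d \<alpha> p q) (Besov_norm M d \<alpha> p q)
                (Lp_space M p') (Lp_norm M p'))) \<and>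
         ((\<exists>(\<alpha>::real) (p::real) (q::ennreal) (p'::real).
              0 < \<alpha> \<and> 0 < p \<and> 0 < q \<and> 0 < p' \<and> p' < p \<and>
              preceq_index \<alpha> q (space M) d \<and>
              (continuous_embedding (TL_space M d \<alpha> p q) (TL_norm M d \<alpha> p q)
                 (Lp_space M p') (Lp_norm M p') \<or>
               continuous_embedding (Besov_space M d \<alpha> p q) (Besov_norm M d \<alpha> p q)
                 (Lp_space M p') (Lp_norm M p'))) \<longrightarrow>
          emeasure M (space M) < \<infinity>)"
proof (intro conjI impI allI)
  fix \<alpha> p p' :: real and q :: ennreal
  assume fin: "emeasure M (space M) < \<infinity>"
    and pos: "0 < \<alpha> \<and> 0 < p \<and> 0 < q \<and> 0 < p' \<and> p' < p"
  show "compact_embedding (TL_space M d \<alpha> p q) (TL_norm M d \<alpha> p q) (Lp_space M p') (Lp_norm M p')"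
  proof (rule compact_embedding_of_finite_measure[OF assms fin])
    show "Lp_norm M p u \<le> TL_norm M d \<alpha> p q u" for u
      by (simp add: TL_norm_def)
    show "\<exists>R'. \<forall>u\<in>TL_space M d \<alpha> p q. TL_norm M d \<alpha> p q u \<le> ennreal R \<longrightarrow>
      (\<exists>g\<in>fractional_gradients M d \<alpha> u. \<forall>k. Lp_norm M p (g k) \<le> ennreal R')" for R
      using pos by (intro exI[of _ "max R 0 + 1"] ballI impI gradient_of_finite_norm[where q = q]) auto
  qed (use pos in \<open>auto simp: TL_space_def\<close>)
  show "compact_embedding (Besov_space M d \<alpha> p q) (Besov_norm M d \<alpha> p q) (Lp_space M p') (Lp_norm M p')"
  proof (rule compact_embedding_of_finite_measure[OF assms fin])
    show "Lp_norm M p u \<le> Besov_norm M d \<alpha> p q u" for u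
      by (simp add: Besov_norm_def)
    show "\<exists>R'. \<forall>u\<in>Besov_space M d \<alpha> p q. Besov_norm M d \<alpha> p q u \<le> ennreal R \<longrightarrow>
      (\<exists>g\<in>fractional_gradients M d \<alpha> u. \<forall>k. Lp_norm M p (g k) \<le> ennreal R')" for R
      using pos by (intro exI[of _ "max R 0 + 1"] ballI impI gradient_of_finite_norm[where q = q]) auto
  qed (use pos in \<open>auto simp: Besov_space_def\<close>)
next
  assume "\<exists>(\<alpha>::real) (p::real) (q::ennreal) (p'::real).
    0 < \<alpha> \<and> 0 < p \<and> 0 < q \<and> 0 < p' \<and> p' < p \<and> preceq_index \<alpha> q (space M) d \<and>
    (continuous_embedding (TL_space M d \<alpha> p q) (TL_norm M d \<alpha> p q) (Lp_space M p') (Lp_norm M p') \<or>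
     continuous_embedding (Besov_space M d \<alpha> p q) (Besov_norm M d \<alpha> p q) (Lp_space M p') (Lp_norm M p'))"
  then obtain \<alpha> p p' :: real and q :: ennreal
    where pos: "0 < \<alpha>" "0 < q" "0 < p'" "p' < p" and pre: "preceq_index \<alpha> q (space M) d"
      and emb: "continuous_embedding (TL_space M d \<alpha> p q) (TL_norm M d \<alpha> p q) (Lp_space M p') (Lp_norm M p') \<or>
       continuous_embedding (Besov_space M d \<alpha> p q) (Besov_norm M d \<alpha> p q) (Lp_space M p') (Lp_norm M p')"
    by blast
  from emb show "emeasure M (space M) < \<infinity>"
  proof
    assume "continuous_embedding (TL_space M d \<alpha> p q) (TL_norm M d \<alpha> p q) (Lp_space M p') (Lp_norm M p')"
    then show ?thesis
      by (rule finite_measure_of_continuous_embedding[OF assms pre pos, rotated -1])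
        (auto simp: TL_space_def)
  next
    assume "continuous_embedding (Besov_space M d \<alpha> p q) (Besov_norm M d \<alpha> p q) (Lp_space M p') (Lp_norm M p')"
    then show ?thesis
      by (rule finite_measure_of_continuous_embedding[OF assms pre pos, rotated -1])
        (auto simp: Besov_space_def)
  qed
qed

end
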